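(* Let $\mathfrak g=\mathfrak{sl}(n,\mathbb C)$, $\lambda\in\mathfrak h^*$, $\lambda_i=(\lambda+\rho)(H_i)$. Let $1\le k<l\le n$ and suppose $\langle\lambda+\rho,e_k-e_l\rangle=m\in\mathbb N$. Put \[ \Gamma^m_{k,l}:=\{a\in\Gamma\ :\ [H,E^a]=m(e_l-e_k)(H)E^a\ \text{for all } H\in\mathfrak h\}. \] For $a\in\Gamma$ and $i=k,\dots,l-1$ define $r_i=\sum_{(q,j):\ j<i+1<q}a_{q,j}$ (so $r_{l-1}=0$) and $u_i=\sum_{j=k}^i\lambda_j$. Then \[ v=\sum_{a\in\Gamma^m_{k,l}}\frac{\prod_{i=k}^{l-1}\langle u_i\rangle_{r_i}\,(m-r_i)!}{\prod_{i>j}a_{i,j}!}\,E^a v_\lambda \] is a singular vector in $M(\lambda)$ of weight $s_{e_k-e_l}\cdot\lambda$.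
   Context: $E_{i,j}$ is the $n\times n$ matrix unit; $H_i=E_{i,i}-E_{i+1,i+1}$ ($1\le i\le n-1$) form a basis of the Cartan subalgebra $\mathfrak h$; $e_i(E_{j,j})=\delta_{ij}$; positive roots $e_i-e_j$ ($i<j$) with root vectors $E_{i,j}$, negative root vectors $E_{i,j}$ ($i>j$); $\mathfrak n=\mathrm{span}\{E_{i,j}:i<j\}$, $\mathfrak b=\mathfrak h\oplus\mathfrak n$; $\rho$ is half the sum of positive roots; $\langle\,,\rangle$ the usual bilinear form on $\mathfrak h^*$. The Verma module is $M(\lambda)=U(\mathfrak g)\otimes_{U(\mathfrak b)}v_\lambda$ where $v_\lambda$ spans the one-dimensional $\mathfrak b$-module of weight $\lambda$ ($\mathfrak n$ acting by $0$). A singular vector is a weight vector $v\in M(\lambda)$ with $\mathfrak n\cdot v=0$. Dot action: $w\cdot\lambda=w(\lambda+\rho)-\rho$, and $s_{e_k-e_l}$ is the reflection in $e_k-e_l$. $\mathbb N=\{0,1,2,\dots\}$. $\Gamma=\sum_{1\le j<i\le n}\mathbb N\epsilon_{i,j}$, and for $a=\sum a_{i,j}\epsilon_{i,j}\in\Gamma$, $E^a=E_{2,1}^{a_{2,1}}E_{3,1}^{a_{3,1}}E_{3,2}^{a_{3,2}}E_{4,1}^{a_{4,1}}\cdots E_{n,1}^{a_{n,1}}\cdots E_{n,n-1}^{a_{n,n-1}}\in U(\mathfrak g)$ (factors ordered by row index $i$, then column index $j$). $\langle\gamma\rangle_k=\gamma(\gamma-1)\cdots(\gamma-k+1)$, $\langle\gamma\rangle_0=1$.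 *)

theory Defs
  imports Complex_Main
begin

text \<open>Concrete model.  Matrices are functions nat => nat => complex, indices 1..n.
 g = sl(n,C) is the set of traceless matrices supported on {1..n}^2.
 U(g) is realised as the tensor algebra T(g) (formal finite linear combinations of
 words over g, i.e. functions from words to complex) modulo the two-sided ideal
 generated by the linearity relations and x y - y x - [x,y].  M(lambda) is T(g) modulo
 that ideal plus the left ideal generated by X - lambda(X) for X in b
 (lambda extended by 0 on n).  A word w represents the element w.v_lambda.\<close>

type_synonym cmat = "nat \<Rightarrow> nat \<Rightarrow> complex"
type_synonym vect = "cmat list \<Rightarrow> complex"

definition sl :: "nat \<Rightarrow> cmat set" where
  "sl n = {X. (\<forall>i j. \<not> (1 \<le> i \<and> i \<le> n \<and> 1 \<le> j \<and> j \<le> n) \<longrightarrow> X i j = 0)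
              \<and> (\<Sum>i=1..n. X i i) = 0}"

definition cartan :: "nat \<Rightarrow> cmat set" where
  "cartan n = {X \<in> sl n. \<forall>i j. i \<noteq> j \<longrightarrow> X i j = 0}"

definition nilp :: "nat \<Rightarrow> cmat set" where
  "nilp n = {X \<in> sl n. \<forall>i j. j \<le> i \<longrightarrow> X i j = 0}"

definition borel :: "nat \<Rightarrow> cmat set" where
  "borel n = {X \<in> sl n. \<forall>i j. j < i \<longrightarrow> X i j = 0}"

definition Emat :: "nat \<Rightarrow> nat \<Rightarrow> cmat" where
  "Emat i j = (\<lambda>p q. if p = i \<and> q = j then 1 else 0)"

definition Hmat :: "nat \<Rightarrow> cmat" where
  "Hmat i = (\<lambda>p q. Emat i i p q - Emat (i+1) (i+1) p q)"

definition madd :: "cmat \<Rightarrow> cmat \<Rightarrow> cmat" where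
  "madd X Y = (\<lambda>i j. X i j + Y i j)"

definition msmult :: "complex \<Rightarrow> cmat \<Rightarrow> cmat" where
  "msmult c X = (\<lambda>i j. c * X i j)"

definition mbracket :: "nat \<Rightarrow> cmat \<Rightarrow> cmat \<Rightarrow> cmat" where
  "mbracket n X Y = (\<lambda>i j. (\<Sum>t=1..n. X i t * Y t j) - (\<Sum>t=1..n. Y i t * X t j))"

definition wd :: "cmat list \<Rightarrow> vect" where
  "wd w = (\<lambda>u. if u = w then 1 else 0)"

definition words :: "nat \<Rightarrow> cmat list set" where
  "words n = {w. set w \<subseteq> sl n}"

inductive_set cspan :: "vect set \<Rightarrow> vect set" for R where
  zero: "(\<lambda>_. 0) \<in> cspan R"
| base: "f \<in> R \<Longrightarrow> f \<in> cspan R"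
| add: "f \<in> cspan R \<Longrightarrow> g \<in> cspan R \<Longrightarrow> (\<lambda>u. f u + g u) \<in> cspan R"
| smult: "f \<in> cspan R \<Longrightarrow> (\<lambda>u. c * f u) \<in> cspan R"

text \<open>spanning set of the two-sided ideal defining U(g) = T(g)/I\<close>
definition Urels :: "nat \<Rightarrow> vect set" where
  "Urels n =
    {f. \<exists>u w X Y c. u \<in> words n \<and> w \<in> words n \<and> X \<in> sl n \<and> Y \<in> sl n \<and>
        f = (\<lambda>t. wd (u @ [madd X (msmult c Y)] @ w) t - wd (u @ [X] @ w) t
                  - c * wd (u @ [Y] @ w) t)}
   \<union> {f. \<exists>u w X Y. u \<in> words n \<and> w \<in> words n \<and> X \<in> sl n \<and> Y \<in> sl n \<and>
        f = (\<lambda>t. wd (u @ [X, Y] @ w) t - wd (u @ [Y, X] @ w) t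
                  - wd (u @ [mbracket n X Y] @ w) t)}"

text \<open>weights are functionals on matrices (only their restriction to h matters).
 lambda in h^* is given by its values Lam p = lambda(H_p), p = 1..n-1; for H in h,
 H = sum_p (sum_{q<=p} H_qq) H_p.\<close>
definition lamf :: "nat \<Rightarrow> (nat \<Rightarrow> complex) \<Rightarrow> cmat \<Rightarrow> complex" where
  "lamf n Lam H = (\<Sum>p=1..n-1. (\<Sum>q=1..p. H q q) * Lam p)"

definition rhof :: "nat \<Rightarrow> cmat \<Rightarrow> complex" where
  "rhof n H = (1/2) * (\<Sum>i=1..n. \<Sum>j=i+1..n. H i i - H j j)"

text \<open>the root e_k - e_l as functional, and its coroot E_kk - E_ll in h
 (so that <mu, e_k - e_l> = mu(E_kk - E_ll) for the usual form, <alpha,alpha> = 2)\<close>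
definition eroot :: "nat \<Rightarrow> nat \<Rightarrow> cmat \<Rightarrow> complex" where
  "eroot k l H = H k k - H l l"

definition coroot :: "nat \<Rightarrow> nat \<Rightarrow> cmat" where
  "coroot k l = (\<lambda>p q. Emat k k p q - Emat l l p q)"

definition reflect :: "nat \<Rightarrow> nat \<Rightarrow> (cmat \<Rightarrow> complex) \<Rightarrow> (cmat \<Rightarrow> complex)" where
  "reflect k l mu = (\<lambda>H. mu H - mu (coroot k l) * eroot k l H)"

definition dot_reflect :: "nat \<Rightarrow> nat \<Rightarrow> nat \<Rightarrow> (cmat \<Rightarrow> complex) \<Rightarrow> (cmat \<Rightarrow> complex)" where
  "dot_reflect n k l mu = (\<lambda>H. reflect k l (\<lambda>H'. mu H' + rhof n H') H - rhof n H)"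

definition Mrels :: "nat \<Rightarrow> (nat \<Rightarrow> complex) \<Rightarrow> vect set" where
  "Mrels n Lam = Urels n \<union>
     {f. \<exists>u X. u \<in> words n \<and> X \<in> borel n \<and>
         f = (\<lambda>t. wd (u @ [X]) t - lamf n Lam X * wd u t)}"

definition lmul :: "cmat \<Rightarrow> vect \<Rightarrow> vect" where
  "lmul X f = (\<lambda>u. case u of [] \<Rightarrow> 0 | Y # u' \<Rightarrow> if Y = X then f u' else 0)"

definition singular :: "nat \<Rightarrow> (nat \<Rightarrow> complex) \<Rightarrow> (cmat \<Rightarrow> complex) \<Rightarrow> vect \<Rightarrow> bool" where
  "singular n Lam mu v \<longleftrightarrow>
     v \<notin> cspan (Mrels n Lam)
   \<and> (\<forall>H \<in> cartan n. (\<lambda>t. lmul H v t - mu H * v t) \<in> cspan (Mrels n Lam))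
   \<and> (\<forall>X \<in> nilp n. lmul X v \<in> cspan (Mrels n Lam))"

definition GammaSet :: "nat \<Rightarrow> (nat \<Rightarrow> nat \<Rightarrow> nat) set" where
  "GammaSet n = {a. \<forall>i j. a i j \<noteq> 0 \<longrightarrow> 1 \<le> j \<and> j < i \<and> i \<le> n}"

definition Eword :: "nat \<Rightarrow> (nat \<Rightarrow> nat \<Rightarrow> nat) \<Rightarrow> cmat list" where
  "Eword n a = concat [replicate (a i j) (Emat i j). i \<leftarrow> [2..<n+1], j \<leftarrow> [1..<i]]"

definition GammaM :: "nat \<Rightarrow> nat \<Rightarrow> nat \<Rightarrow> nat \<Rightarrow> (nat \<Rightarrow> nat \<Rightarrow> nat) set" where
  "GammaM n m k l = {a \<in> GammaSet n. \<forall>H \<in> cartan n.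
      (\<lambda>t. wd ([H] @ Eword n a) t - wd (Eword n a @ [H]) t
           - of_nat m * (H l l - H k k) * wd (Eword n a) t) \<in> cspan (Urels n)}"

definition ffall :: "complex \<Rightarrow> nat \<Rightarrow> complex" where
  "ffall g k = (\<Prod>t<k. g - of_nat t)"

definition lam_i :: "nat \<Rightarrow> (nat \<Rightarrow> complex) \<Rightarrow> nat \<Rightarrow> complex" where
  "lam_i n Lam i = lamf n Lam (Hmat i) + rhof n (Hmat i)"

definition u_i :: "nat \<Rightarrow> (nat \<Rightarrow> complex) \<Rightarrow> nat \<Rightarrow> nat \<Rightarrow> complex" where
  "u_i n Lam k i = (\<Sum>j=k..i. lam_i n Lam j)"

definition r_i :: "nat \<Rightarrow> (nat \<Rightarrow> nat \<Rightarrow> nat) \<Rightarrow> nat \<Rightarrow> nat" where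
  "r_i n a i = (\<Sum>q=1..n. \<Sum>j=1..n. if j < i + 1 \<and> i + 1 < q then a q j else 0)"

definition coeff :: "nat \<Rightarrow> (nat \<Rightarrow> complex) \<Rightarrow> nat \<Rightarrow> nat \<Rightarrow> nat \<Rightarrow> (nat \<Rightarrow> nat \<Rightarrow> nat) \<Rightarrow> complex" where
  "coeff n Lam m k l a =
     (\<Prod>i=k..l-1. ffall (u_i n Lam k i) (r_i n a i) * of_nat (fact (m - r_i n a i)))
     / of_nat (\<Prod>i=1..n. \<Prod>j=1..n. if j < i then fact (a i j) else 1)"

end

theory Submission
  imports Defs "HOL-Library.Multiset"
begin

text \<open>
  The Verma module is realised on polynomials in variables \<open>x i j\<close> (\<open>i > j\<close>), the monomial
  \<open>x^a\<close> standing for \<open>E^a v\<close>; the operators are obtained by adding one column of variables at a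
  time (parabolic induction from gl on the indices \<open>{c+1..n}\<close> to gl on \<open>{c..n}\<close>).  Every word is,
  modulo the defining ideal of the Verma module, a combination of the words \<open>E^a\<close>, and these are mapped to
  distinct monomials; hence an element of the tensor algebra lies in the ideal as soon as it acts as
  zero in the model.

  In the model \<open>E_{i,i+1}\<close> is an explicit differential operator.  Its coefficient at \<open>x^b\<close> on the claimed
  vector involves only row and column sums of \<open>b\<close>, which the weight condition expresses through
  \<open>m\<close>, \<open>r_{i-1}\<close> and \<open>r_i\<close>; it then telescopes to zero because \<open>u_i = u_{i-1} + \<lambda>_i\<close> and
  \<open>u_{l-1} = m\<close>.  The vector is nonzero because its coefficient at the product of the
  \<open>E_{i+1,i}^m\<close>, where all \<open>r_i\<close> vanish, does not vanish.
\<close>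

section \<open>One step of parabolic induction for gl\<close>

text \<open>Showing that the vector is nonzero and deciding which a lie in \<open>GammaM\<close>
  both need linear independence of the ordered words. Exhibiting relations cannot give this, so a
  model in which the words act as distinct monomials is built; it also replaces the straightening of
  E_{i,i+1} E^a by one closed formula. gl is used instead of sl because its brackets are Kronecker
  deltas and because the Levi factor at each step is again a smaller gl times scalars. Columns are
  adjoined because the new lower elements E_{i,c}, i > c, commute with each other and can act as
  plain multiplications.

  The numbers in the coefficient have a combinatorial meaning. Read a as a flow on the vertices 1..n
  that carries a_{i,j} units along the edge from j to i. The weight condition says that m units
  enter at k, leave at l, and are conserved elsewhere. Then r_i is the amount that jumps over the
  vertex i+1, and m - r_i is the amount that stops there, so (m - r_i)! is the factorial of a row
  sum.\<close>

definition comm :: "'a::ring_1 \<Rightarrow> 'a \<Rightarrow> 'a" where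
  "comm a b = a * b - b * a"

lemma comm_add_left: "comm (a + b) c = comm a c + comm b c"
  and comm_add_right: "comm a (b + c) = comm a b + comm a c"
  and comm_diff_left: "comm (a - b) c = comm a c - comm b c"
  and comm_diff_right: "comm a (b - c) = comm a b - comm a c"
  and comm_minus_left: "comm (- a) c = - comm a c"
  and comm_minus_right: "comm a (- c) = - comm a c"
  and comm_mult_left: "comm (a * b) c = a * comm b c + comm a c * b"
  and comm_mult_right: "comm a (b * c) = comm a b * c + b * comm a c"
  by (simp_all add: comm_def algebra_simps)

lemma comm_self [simp]: "comm a a = 0"
  by (simp add: comm_def)

lemma comm_zero [simp]: "comm 0 a = 0" "comm a 0 = 0"
  by (simp_all add: comm_def)

lemma comm_flip: "comm b a = - comm a b"
  by (simp add: comm_def)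

lemma comm_sum_left: "comm (\<Sum>i\<in>A. f i) c = (\<Sum>i\<in>A. comm (f i) c)"
  by (simp add: comm_def sum_distrib_left sum_distrib_right sum_subtractf)

lemma comm_sum_right: "comm c (\<Sum>i\<in>A. f i) = (\<Sum>i\<in>A. comm c (f i))"
  by (simp add: comm_def sum_distrib_left sum_distrib_right sum_subtractf)

lemmas comm_bilinear = comm_add_left comm_add_right comm_diff_left comm_diff_right
  comm_minus_left comm_minus_right comm_mult_left comm_mult_right comm_sum_left comm_sum_right

definition gl_rel :: "nat set \<Rightarrow> (nat \<Rightarrow> nat \<Rightarrow> 'a::ring_1) \<Rightarrow> bool" where
  "gl_rel I R \<longleftrightarrow> (\<forall>i\<in>I. \<forall>j\<in>I. \<forall>k\<in>I. \<forall>l\<in>I.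
     comm (R i j) (R k l) = (if j = k then R i l else 0) - (if l = i then R k j else 0))"

text \<open>Here \<open>x i\<close> is the action of \<open>E_{i,c}\<close>; the formula for \<open>E_{c,j}\<close> is what results from moving it
  to the right past the \<open>x k\<close> until it meets a vector it annihilates.\<close>

definition gl_ext :: "nat \<Rightarrow> nat set \<Rightarrow> (nat \<Rightarrow> nat \<Rightarrow> 'a::ring_1) \<Rightarrow> (nat \<Rightarrow> 'a) \<Rightarrow> (nat \<Rightarrow> 'a) \<Rightarrow> 'a
    \<Rightarrow> nat \<Rightarrow> nat \<Rightarrow> 'a" where
  "gl_ext c I R x d mu i j =
     (if i = c then
        if j = c then mu - (\<Sum>k\<in>I. x k * d k)
        else (mu - (\<Sum>k\<in>I. x k * d k)) * d j - (\<Sum>k\<in>I. R k j * d k)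
      else if j = c then x i else R i j + x i * d j)"

text \<open>The situation abstracts polynomials in the \<open>x k\<close> with coefficients in a
  gl(I)-module: \<open>R\<close> is the action on the coefficients, and \<open>x\<close>,
  \<open>d\<close> generate a Weyl algebra commuting with \<open>R\<close> and with the weight
  \<open>mu\<close> of E_{c,c}. Only these relations enter, so one computation serves every
  column.\<close>

locale gl_step =
  fixes c :: nat and I :: "nat set" and R :: "nat \<Rightarrow> nat \<Rightarrow> 'a::ring_1"
    and x d :: "nat \<Rightarrow> 'a" and mu :: 'a
  assumes fin: "finite I" and cI: "c \<notin> I"
    and RR: "gl_rel I R"
    and Rx: "\<And>i j k. i \<in> I \<Longrightarrow> j \<in> I \<Longrightarrow> k \<in> I \<Longrightarrow> comm (R i j) (x k) = 0"
    and Rd: "\<And>i j k. i \<in> I \<Longrightarrow> j \<in> I \<Longrightarrow> k \<in> I \<Longrightarrow> comm (R i j) (d k) = 0"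
    and xx: "\<And>i k. i \<in> I \<Longrightarrow> k \<in> I \<Longrightarrow> comm (x i) (x k) = 0"
    and dd: "\<And>i k. i \<in> I \<Longrightarrow> k \<in> I \<Longrightarrow> comm (d i) (d k) = 0"
    and dx: "\<And>i k. i \<in> I \<Longrightarrow> k \<in> I \<Longrightarrow> comm (d i) (x k) = (if i = k then 1 else 0)"
    and mx: "\<And>k. k \<in> I \<Longrightarrow> comm mu (x k) = 0"
    and md: "\<And>k. k \<in> I \<Longrightarrow> comm mu (d k) = 0"
    and mR: "\<And>i j. i \<in> I \<Longrightarrow> j \<in> I \<Longrightarrow> comm mu (R i j) = 0"
begin

text \<open>\<open>N\<close> is the Euler operator of the new column. \<open>S j\<close> collects
  the terms of E_{c,j} in which a factor x_k is consumed through [E_{c,j}, E_{k,c}] and leaves the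
  inner action of E_{k,j} behind.\<close>

abbreviation "N \<equiv> \<Sum>k\<in>I. x k * d k"
abbreviation "S j \<equiv> \<Sum>k\<in>I. R k j * d k"
abbreviation "E \<equiv> gl_ext c I R x d mu"

lemma RR': "i \<in> I \<Longrightarrow> j \<in> I \<Longrightarrow> k \<in> I \<Longrightarrow> l \<in> I \<Longrightarrow>
     comm (R i j) (R k l) = (if j = k then R i l else 0) - (if l = i then R k j else 0)"
  using RR by (auto simp: gl_rel_def)

lemma comm_gens_flip: assumes "i \<in> I" "j \<in> I" "k \<in> I"
  shows "comm (x k) (R i j) = 0" "comm (d k) (R i j) = 0" "comm (x k) (d i) = (if i = k then -1 else 0)"
    "comm (x k) mu = 0" "comm (d k) mu = 0" "comm (R i j) mu = 0"
  using comm_flip[of "x k"] comm_flip[of "d k"] comm_flip[of "R i j" mu] assms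
  by (auto simp: Rx Rd dx mx md mR)

lemmas comm_gens = RR' Rx Rd xx dd dx mx md mR comm_gens_flip

lemma if_zero_mult: "(if P then a else (0::'a)) * b = (if P then a * b else 0)"
   "b * (if P then a else (0::'a)) = (if P then b * a else 0)"
  "- (if P then a else (0::'a)) = (if P then - a else 0)"
  by auto

lemma sum_delta_I: "i \<in> I \<Longrightarrow> (\<Sum>k\<in>I. if k = i then f k else 0) = (f i ::'a)"
   "i \<in> I \<Longrightarrow> (\<Sum>k\<in>I. if i = k then f k else 0) = (f i ::'a)"
  using fin by (simp_all add: sum.delta)

text \<open>\<open>N\<close> measures degree: \<open>x\<close> has degree 1, \<open>d\<close> has
  degree -1, and \<open>R\<close> and \<open>mu\<close> have degree 0.\<close>

lemma comm_N: assumes "i \<in> I" "j \<in> I" 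
  shows "comm N (x i) = x i" "comm N (d i) = - d i" "comm N (R i j) = 0" "comm N mu = 0"
    "comm (x i) N = - x i" "comm (d i) N = d i" "comm (R i j) N = 0" "comm mu N = 0"
  using assms by (simp_all add: comm_bilinear comm_gens if_zero_mult sum_delta_I cong: sum.cong if_cong)

lemma comm_S: assumes "i \<in> I" "j \<in> I" "l \<in> I"
  shows "comm (S l) (x i) = R i l" "comm (S l) (d i) = 0" "comm (d i) (S l) = 0" "comm (x i) (S l) = - R i l"
    "comm (R i j) (S l) = R i l * d j - (if i = l then S j else 0)" "comm (S l) mu = 0" "comm mu (S l) = 0"
    "comm (S l) N = S l" "comm N (S l) = - S l"
proof -
  show "comm (S l) (x i) = R i l" "comm (S l) (d i) = 0" "comm (d i) (S l) = 0" "comm (x i) (S l) = - R i l"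
    "comm (S l) mu = 0" "comm mu (S l) = 0"
    using assms by (simp_all add: comm_bilinear comm_gens if_zero_mult sum_delta_I cong: sum.cong if_cong)
  show "comm (R i j) (S l) = R i l * d j - (if i = l then S j else 0)"
    using assms by (simp add: comm_sum_right comm_mult_right comm_gens if_zero_mult sum_delta_I sum_subtractf left_diff_distrib
      cong: sum.cong if_cong)
  have "comm (R k l * d k) N = R k l * d k" if "k \<in> I" for k
    using that assms by (simp add: comm_mult_left comm_N del: comm_sum_right)
  then show "comm (S l) N = S l"
    by (simp add: comm_sum_left cong: sum.cong)
  then show "comm N (S l) = - S l"
    by (metis comm_flip)
qed

lemma SS: assumes "j \<in> I" "l \<in> I"
  shows "comm (S j) (S l) = S l * d j - S j * d l"
proof -
  have "comm (R k j * d k) (S l) = R k l * (d j * d k) - (if k = l then S j * d k else 0)" if "k \<in> I" for k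
    using that assms by (simp add: comm_mult_left comm_S left_diff_distrib if_zero_mult mult.assoc)
  then have "comm (S j) (S l) = (\<Sum>k\<in>I. R k l * (d j * d k)) - S j * d l"
    using assms by (simp add: comm_sum_left sum_subtractf sum_delta_I cong: sum.cong)
  moreover have "d j * d k = d k * d j" if "k \<in> I" for k
    using dd[OF assms(1) that] by (simp add: comm_def)
  ultimately show ?thesis
    by (simp add: sum_distrib_right mult.assoc cong: sum.cong)
qed

abbreviation "U j \<equiv> (mu - N) * d j - S j"

lemma E_simps: "i \<in> I \<Longrightarrow> j \<in> I \<Longrightarrow> E i j = R i j + x i * d j"
  "i \<in> I \<Longrightarrow> E i c = x i" "j \<in> I \<Longrightarrow> E c j = U j" "E c c = mu - N"
  using cI by (auto simp: gl_ext_def)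

text \<open>This is the delicate bracket of the step. \<open>S\<close> has degree -1, so commuting
  it with \<open>mu - N\<close> leaves the cross terms S_j d_l - S_l d_j, and these are cancelled by
  the bracket of \<open>S j\<close> with \<open>S l\<close> computed in \<open>SS\<close>.\<close>

lemma UU: assumes "j \<in> I" "l \<in> I"
  shows "comm (U j) (U l) = 0"
proof -
  have "d j * d l = d l * d j"
    using dd[OF assms] by (simp add: comm_def)
  then show ?thesis
    using assms by (auto simp add: comm_add_left comm_add_right comm_diff_left comm_diff_right
  comm_minus_left comm_minus_right comm_mult_left comm_mult_right SS comm_N comm_S comm_gens mult.assoc left_diff_distrib right_diff_distrib distrib_left distrib_right)
qed

lemma DU: assumes "i \<in> I" "j \<in> I" "l \<in> I"
  shows "comm (R i j + x i * d j) (U l) = - (if l = i then U j else 0)"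
  using assms
  by (auto simp add: comm_add_left comm_add_right comm_diff_left comm_diff_right
  comm_minus_left comm_minus_right comm_mult_left comm_mult_right SS comm_N comm_S comm_gens mult.assoc left_diff_distrib right_diff_distrib distrib_left distrib_right)
lemma xU: assumes "i \<in> I" "l \<in> I"
  shows "comm (x i) (U l) = R i l + x i * d l - (if l = i then mu - N else 0)"
  using assms
  by (auto simp add: comm_add_left comm_add_right comm_diff_left comm_diff_right
  comm_minus_left comm_minus_right comm_mult_left comm_mult_right SS comm_N comm_S comm_gens mult.assoc left_diff_distrib right_diff_distrib distrib_left distrib_right)
lemma CU: assumes "l \<in> I"
  shows "comm (mu - N) (U l) = U l"
  using assms
  by (auto simp add: comm_add_left comm_add_right comm_diff_left comm_diff_right
  comm_minus_left comm_minus_right comm_mult_left comm_mult_right SS comm_N comm_S comm_gens mult.assoc left_diff_distrib right_diff_distrib distrib_left distrib_right)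
lemma DD: assumes "i \<in> I" "j \<in> I" "k \<in> I" "l \<in> I"
  shows "comm (R i j + x i * d j) (R k l + x k * d l) =
     (if j = k then R i l + x i * d l else 0) - (if l = i then R k j + x k * d j else 0)"
  using assms
  by (auto simp add: comm_add_left comm_add_right comm_diff_left comm_diff_right
  comm_minus_left comm_minus_right comm_mult_left comm_mult_right SS comm_N comm_S comm_gens mult.assoc left_diff_distrib right_diff_distrib distrib_left distrib_right)

lemma comm_lower: assumes "i \<in> I" "k \<in> I" "l \<in> I"
  shows "comm (mu - N) (x k) = - x k" "comm (mu - N) (R k l + x k * d l) = 0"
    "comm (x i) (R k l + x k * d l) = - (if l = i then x k else 0)"
  using assms by (auto simp add: comm_add_left comm_add_right comm_diff_left comm_diff_right
    comm_mult_left comm_mult_right comm_N comm_gens)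

lemmas comm_table = UU DU xU CU DD comm_lower xx

text \<open>Antisymmetry loops as a rewrite rule, so the case analysis in \<open>gl_rel_ext\<close>
  is given both orientations of the brackets.\<close>

lemma comm_flipped_table: assumes "i \<in> I" "k \<in> I" "l \<in> I"
  shows "comm (x k) (mu - N) = x k" "comm (R k l + x k * d l) (mu - N) = 0"
    "comm (R k l + x k * d l) (x i) = (if l = i then x k else 0)"
    "comm (U l) (R i k + x i * d k) = (if l = i then U k else 0)"
    "comm (U l) (x i) = (if l = i then mu - N else 0) - (R i l + x i * d l)"
    "comm (U l) (mu - N) = - U l"
  unfolding comm_flip[of "x k" "mu - N"] comm_flip[of "R k l + x k * d l" "mu - N"]
    comm_flip[of "R k l + x k * d l" "x i"] comm_flip[of "U l" "R i k + x i * d k"]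
    comm_flip[of "U l" "x i"] comm_flip[of "U l" "mu - N"]
  using assms by (simp_all add: comm_table)

theorem gl_rel_ext: "gl_rel (insert c I) E"
proof -
  have cc: "c \<noteq> i" "i \<noteq> c" if "i \<in> I" for i
    using that cI by auto
  have "comm (E i j) (E k l) = (if j = k then E i l else 0) - (if l = i then E k j else 0)"
    if "i \<in> insert c I" "j \<in> insert c I" "k \<in> insert c I" "l \<in> insert c I" for i j k l
    using that
    by (elim insertE) (simp_all add: cc E_simps comm_table comm_flipped_table comm_self del: comm_zero)
  then show ?thesis by (simp add: gl_rel_def)
qed

end

section \<open>Differential operators on formal power series\<close>

text \<open>All operators below are defined coefficientwise, so no finite-support condition is imposed.\<close>

type_synonym pseries = "(nat \<times> nat \<Rightarrow> nat) \<Rightarrow> complex"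

text \<open>Packaging linear endomorphisms as a type makes them an instance of
  \<open>ring_1\<close>, as the locale for the induction step requires. Additivity is built in
  because composition distributes over a sum on its right only for additive maps.\<close>

typedef lop = "{F :: pseries \<Rightarrow> pseries.
    (\<forall>f g. F (\<lambda>a. f a + g a) = (\<lambda>a. F f a + F g a)) \<and> (\<forall>c f. F (\<lambda>a. c * f a) = (\<lambda>a. c * F f a))}"
  morphisms app Lop
  by (rule exI[of _ "\<lambda>f. f"]) simp

setup_lifting type_definition_lop

lemma app_add: "app A (\<lambda>a. f a + g a) = (\<lambda>a. app A f a + app A g a)"
  and app_scale: "app A (\<lambda>a. c * f a) = (\<lambda>a. c * app A f a)"
  using app[of A] by simp_all

instantiation lop :: ring_1
begin

lift_definition zero_lop :: lop is "\<lambda>f a. 0" by simp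
lift_definition one_lop :: lop is "\<lambda>f. f" by simp
lift_definition plus_lop :: "lop \<Rightarrow> lop \<Rightarrow> lop" is "\<lambda>F G f a. F f a + G f a"
  by (simp add: algebra_simps)
lift_definition minus_lop :: "lop \<Rightarrow> lop \<Rightarrow> lop" is "\<lambda>F G f a. F f a - G f a"
  by (simp add: algebra_simps)
lift_definition uminus_lop :: "lop \<Rightarrow> lop" is "\<lambda>F f a. - F f a"
  by simp
lift_definition times_lop :: "lop \<Rightarrow> lop \<Rightarrow> lop" is "\<lambda>F G f. F (G f)"
  by simp

instance
proof
  show "(0::lop) \<noteq> 1"
  proof
    assume "(0::lop) = 1"
    then have "app 0 (\<lambda>_. 1) = app 1 (\<lambda>_. 1)" by simp
    then show False by (simp add: zero_lop.rep_eq one_lop.rep_eq fun_eq_iff)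
  qed
qed (transfer; simp add: algebra_simps)+

end

lemmas app_ops = zero_lop.rep_eq one_lop.rep_eq plus_lop.rep_eq minus_lop.rep_eq
  uminus_lop.rep_eq times_lop.rep_eq

lemma app_sum: "app (\<Sum>i\<in>I. A i) f a = (\<Sum>i\<in>I. app (A i) f a)"
  by (induction I rule: infinite_finite_induct) (simp_all add: app_ops)

lemma app_zero [simp]: "app A (\<lambda>a. 0) = (\<lambda>a. 0)"
  using app_scale[of A 0 "\<lambda>_. 0"] by simp

lemma lop_eqI: "(\<And>f a. app A f a = app B f a) \<Longrightarrow> A = B"
  by (metis app_inject ext)

section \<open>Scalars, multiplications and derivatives as operators\<close>

lift_definition sc :: "complex \<Rightarrow> lop" is "\<lambda>c f a. c * f a"
  by (simp add: algebra_simps)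

text \<open>The coefficient of x_p f at the exponent a is that of f at a lowered by one in p. The
  test for 0 is essential: truncated subtraction would otherwise return the coefficient at a
  itself.\<close>

lift_definition mul_var :: "nat \<times> nat \<Rightarrow> lop" is
  "\<lambda>p f a. if a p = 0 then 0 else f (a(p := a p - 1))"
  by (simp add: fun_eq_iff)

lift_definition der_var :: "nat \<times> nat \<Rightarrow> lop" is
  "\<lambda>p f a. of_nat (a p + 1) * f (a(p := a p + 1))"
  by (simp add: fun_eq_iff algebra_simps)

lemma app_sc: "app (sc c) f a = c * f a"
  by (simp add: sc.rep_eq)

lemma comm_sc [simp]: "comm (sc c) A = 0" "comm A (sc c) = 0"
  by (rule lop_eqI; simp add: comm_def app_ops sc.rep_eq app_scale)+

lemma sc_mult_left: "A * sc c = sc c * A"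
  using comm_sc(2)[of A c] by (simp add: comm_def)

lemma sc_add: "sc (a + b) = sc a + sc b" and sc_diff: "sc (a - b) = sc a - sc b"
  and sc_mult: "sc (a * b) = sc a * sc b" and sc_0: "sc 0 = 0" and sc_1: "sc 1 = 1"
  by (rule lop_eqI; simp add: app_ops sc.rep_eq algebra_simps)+

lemma comm_mul_var: "comm (mul_var p) (mul_var q) = 0"
  by (rule lop_eqI) (cases "p = q", auto simp: comm_def app_ops mul_var.rep_eq fun_upd_twist)

lemma comm_der_var: "comm (der_var p) (der_var q) = 0"
  by (rule lop_eqI) (cases "p = q", auto simp: comm_def app_ops der_var.rep_eq fun_upd_twist)

lemma comm_der_mul: "comm (der_var p) (mul_var q) = (if p = q then 1 else 0)"
  by (rule lop_eqI) (cases "p = q", auto simp: comm_def app_ops der_var.rep_eq mul_var.rep_eq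
    fun_upd_twist algebra_simps of_nat_diff)

lemma comm_mul_der: "comm (mul_var q) (der_var p) = (if p = q then -1 else 0)"
  using comm_flip[of "mul_var q" "der_var p"] by (simp add: comm_der_mul)

text \<open>Stage s carries an action of gl on the indices n-s..n. It starts from the
  one-dimensional module of gl({n}), where only the entry (n, n) has a meaning, and each step
  adjoins the column n - s - 1 of variables.\<close>

primrec glV :: "nat \<Rightarrow> (nat \<Rightarrow> complex) \<Rightarrow> nat \<Rightarrow> nat \<Rightarrow> nat \<Rightarrow> lop" where
  "glV n mu 0 = (\<lambda>i j. sc (mu n))"
| "glV n mu (Suc s) = gl_ext (n - Suc s) {n - s..n} (glV n mu s)
     (\<lambda>i. mul_var (i, n - Suc s)) (\<lambda>i. der_var (i, n - Suc s)) (sc (mu (n - Suc s)))"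

text \<open>Stage s only involves variables of the columns n-s and above, hence commutes with those
  of any column still to come. This supplies the hypotheses \<open>Rx\<close> and \<open>Rd\<close>
  of the next step.\<close>

lemma comm_glV_var:
  assumes "c < n - s"
  shows "comm (glV n mu s i j) (mul_var (k, c)) = 0 \<and> comm (glV n mu s i j) (der_var (k, c)) = 0"
  using assms
proof (induction s arbitrary: i j)
  case 0
  then show ?case by simp
next
  case (Suc s)
  then have "c < n - s" "c \<noteq> n - Suc s" by auto
  with Suc.IH show ?case
    by (auto simp: gl_ext_def comm_bilinear comm_mul_var comm_der_var comm_der_mul comm_mul_der)
qed

lemma gl_rel_glV: "s < n \<Longrightarrow> gl_rel {n - s..n} (glV n mu s)"
proof (induction s)
  case 0
  then show ?case by (auto simp: gl_rel_def)
next
  case (Suc s)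
  then have *: "n - Suc s < n - s" by simp
  have "gl_step (n - Suc s) {n - s..n} (glV n mu s) (\<lambda>i. mul_var (i, n - Suc s))
      (\<lambda>i. der_var (i, n - Suc s)) (sc (mu (n - Suc s)))"
    by unfold_locales (use Suc comm_glV_var[OF *] in
      \<open>auto simp: comm_mul_var comm_der_var comm_der_mul\<close>)
  then have "gl_rel (insert (n - Suc s) {n - s..n}) (glV n mu (Suc s))"
    using gl_step.gl_rel_ext by fastforce
  moreover have "insert (n - Suc s) {n - s..n} = {n - Suc s..n}"
    using Suc.prems by auto
  ultimately show ?case by simp
qed

text \<open>E_{i,j} is born as multiplication by x_{i,j} when column j is adjoined; each later
  column c < j adds the vector field x_{i,c} d_{j,c}.\<close>

lemma glV_lower:
  assumes "s < n" "n - s \<le> j" "j < i" "i \<le> n"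
  shows "glV n mu s i j = mul_var (i, j) + (\<Sum>c=n - s..<j. mul_var (i, c) * der_var (j, c))"
  using assms
proof (induction s)
  case 0
  then show ?case by simp
next
  case (Suc s)
  show ?case
  proof (cases "j = n - Suc s")
    case True
    with Suc.prems show ?thesis by (simp add: gl_ext_def)
  next
    case False
    with Suc.prems have "{n - Suc s..<j} = insert (n - Suc s) {n - s..<j}" by auto
    with False Suc show ?thesis by (simp add: gl_ext_def add_ac)
  qed
qed

text \<open>Column i contributes the weight minus its degree, and each later column adds the degree
  in its variable of row i. On a monomial this is \<open>mu i\<close> minus a column sum plus a row
  sum.\<close>

lemma glV_diag:
  assumes "s < n" "n - s \<le> i" "i \<le> n"
  shows "glV n mu s i i = sc (mu i) - (\<Sum>k\<in>{i<..n}. mul_var (k, i) * der_var (k, i))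
     + (\<Sum>c=n - s..<i. mul_var (i, c) * der_var (i, c))"
  using assms
proof (induction s)
  case 0
  then show ?case by simp
next
  case (Suc s)
  show ?case
  proof (cases "i = n - Suc s")
    case True
    with Suc.prems have "{i<..n} = {n - s..n}" by auto
    with True show ?thesis by (simp add: gl_ext_def)
  next
    case False
    with Suc.prems have "{n - Suc s..<i} = insert (n - Suc s) {n - s..<i}" by auto
    with False Suc show ?thesis by (simp add: gl_ext_def add_ac)
  qed
qed

text \<open>A closed form is available because, when column i is adjoined, i+1 is the smallest index
  of the old block. The entries E_{k,i+1} needed for the new row are then bare multiplications for k
  > i+1, and a diagonal entry for k = i+1; no raising operator of the old block occurs.\<close>

lemma glV_super:
  assumes "s < n" "n - s \<le> i" "i < n"
  shows "glV n mu s i (i + 1) = (\<Sum>c=n - s..<i. mul_var (i, c) * der_var (i + 1, c))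
     - (\<Sum>k\<in>{i+1<..n}. mul_var (k, i + 1) * der_var (k, i))
     + (sc (mu i) - sc (mu (i + 1)) - (\<Sum>k\<in>{i<..n}. mul_var (k, i) * der_var (k, i))
        + (\<Sum>k\<in>{i+1<..n}. mul_var (k, i + 1) * der_var (k, i + 1))) * der_var (i + 1, i)"
  using assms
proof (induction s)
  case 0
  then show ?case by simp
next
  case (Suc s)
  show ?case
  proof (cases "i = n - Suc s")
    case True
    with Suc.prems have *: "{i<..n} = {n - s..n}" "n - s = i + 1" "{n - s..n} = insert (i + 1) {i + 1<..n}"
      by auto
    have low: "glV n mu s k (i + 1) = mul_var (k, i + 1)" if "k \<in> {i+1<..n}" for k
      using that Suc.prems * by (subst glV_lower) auto
    have dia: "glV n mu s (i + 1) (i + 1) = sc (mu (i + 1))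
        - (\<Sum>k\<in>{i+1<..n}. mul_var (k, i + 1) * der_var (k, i + 1))"
      using Suc.prems * by (subst glV_diag) auto
    have eq: "(\<Sum>k\<in>{n - s..n}. glV n mu s k (i + 1) * der_var (k, i)) =
       (sc (mu (i + 1)) - (\<Sum>k\<in>{i+1<..n}. mul_var (k, i + 1) * der_var (k, i + 1))) * der_var (i + 1, i)
       + (\<Sum>k\<in>{i+1<..n}. mul_var (k, i + 1) * der_var (k, i))"
    proof -
      have "(\<Sum>k\<in>{i+1<..n}. glV n mu s k (i + 1) * der_var (k, i))
          = (\<Sum>k\<in>{i+1<..n}. mul_var (k, i + 1) * der_var (k, i))"
        by (intro sum.cong refl) (simp only: low)
      then show ?thesis unfolding *(3) by (simp add: dia[simplified])
    qed
    have step: "glV n mu (Suc s) i (i + 1)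
        = (sc (mu i) - (\<Sum>k\<in>{n - s..n}. mul_var (k, i) * der_var (k, i))) * der_var (i + 1, i)
          - (\<Sum>k\<in>{n - s..n}. glV n mu s k (i + 1) * der_var (k, i))"
      by (simp add: gl_ext_def True)
    have "{n - Suc s..<i} = {}" using True by simp
    then show ?thesis
      unfolding step eq unfolding *(1)[symmetric]
      by (simp add: algebra_simps)
  next
    case False
    with Suc.prems have "{n - Suc s..<i} = insert (n - Suc s) {n - s..<i}" by auto
    with False Suc show ?thesis by (simp add: gl_ext_def add_ac)
  qed
qed

definition vac :: pseries where
  "vac a = (if a = (\<lambda>_. 0) then 1 else 0)"

lemma der_vac: "app (der_var p) vac = (\<lambda>_. 0)"
proof
  fix a :: "nat \<times> nat \<Rightarrow> nat"
  have "a(p := a p + 1) \<noteq> (\<lambda>_. 0)" by (metis Suc_eq_plus1 fun_upd_same nat.distinct(1))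
  then show "app (der_var p) vac a = 0" by (simp add: der_var.rep_eq vac_def)
qed

text \<open>When its row is adjoined, E_{i,j} is a sum of operators ending in a derivative, which
  kills the constant 1; later columns only add further terms of this kind.\<close>

lemma glV_upper_vac:
  assumes "s < n" "n - s \<le> i" "i < j" "j \<le> n"
  shows "app (glV n mu s i j) vac = (\<lambda>_. 0)"
  using assms
proof (induction s)
  case 0
  then show ?case by simp
next
  case (Suc s)
  then show ?case
    by (cases "i = n - Suc s") (auto simp: gl_ext_def app_ops app_sum der_vac fun_eq_iff)
qed

lemma glV_diag_vac:
  assumes "s < n" "n - s \<le> i" "i \<le> n"
  shows "app (glV n mu s i i) vac = (\<lambda>a. mu i * vac a)"
  by (simp add: glV_diag[OF assms] app_ops app_sum der_vac app_sc fun_eq_iff)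

section \<open>The representation and the map from the tensor algebra\<close>

text \<open>The weight of \<open>gl(n)\<close> extending \<open>Lam\<close>, normalised by \<open>mu_n = 0\<close>.\<close>

definition mu_of :: "nat \<Rightarrow> (nat \<Rightarrow> complex) \<Rightarrow> nat \<Rightarrow> complex" where
  "mu_of n Lam i = (\<Sum>p=i..<n. Lam p)"

abbreviation gen :: "nat \<Rightarrow> (nat \<Rightarrow> complex) \<Rightarrow> nat \<Rightarrow> nat \<Rightarrow> lop" where
  "gen n Lam \<equiv> glV n (mu_of n Lam) (n - 1)"

definition rep :: "nat \<Rightarrow> (nat \<Rightarrow> complex) \<Rightarrow> cmat \<Rightarrow> lop" where
  "rep n Lam X = (\<Sum>i=1..n. \<Sum>j=1..n. sc (X i j) * gen n Lam i j)"

lemma sc_sum: "sc (\<Sum>i\<in>A. f i) = (\<Sum>i\<in>A. sc (f i))"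
  by (induction A rule: infinite_finite_induct) (simp_all add: sc_0 sc_add)

lemma rep_linear: "rep n Lam (madd X (msmult c Y)) = rep n Lam X + sc c * rep n Lam Y"
  by (simp add: rep_def madd_def msmult_def sc_add sc_mult distrib_right sum.distrib
      sum_distrib_left mult.assoc)

lemma rep_Emat:
  assumes "1 \<le> i" "i \<le> n" "1 \<le> j" "j \<le> n"
  shows "rep n Lam (Emat i j) = gen n Lam i j"
proof -
  have "rep n Lam (Emat i j) = (\<Sum>p=1..n. \<Sum>q=1..n. if p = i then (if q = j then gen n Lam i j else 0) else 0)"
    unfolding rep_def by (intro sum.cong refl) (auto simp: Emat_def sc_1 sc_0)
  also have "\<dots> = (\<Sum>p=1..n. if p = i then gen n Lam i j else 0)"
    by (intro sum.cong refl) (use assms in \<open>simp add: sum.delta\<close>)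
  also have "\<dots> = gen n Lam i j"
    using assms by (simp add: sum.delta)
  finally show ?thesis .
qed

lemma gl_rel_gen: "1 \<le> n \<Longrightarrow> gl_rel {1..n} (gen n Lam)"
  using gl_rel_glV[of "n - 1" n] by simp

lemma rep_bracket:
  assumes "1 \<le> n"
  shows "rep n Lam (mbracket n X Y) = comm (rep n Lam X) (rep n Lam Y)"
proof -
  let ?I = "{1..n}" and ?G = "gen n Lam"
  have scs: "comm (sc a * A) (sc b * B) = sc (a * b) * comm A B" for a b A B
    by (simp add: comm_mult_left comm_mult_right sc_mult) (metis mult.assoc sc_mult_left)
  have "comm (rep n Lam X) (rep n Lam Y)
      = (\<Sum>i\<in>?I. \<Sum>j\<in>?I. \<Sum>k\<in>?I. \<Sum>l\<in>?I. sc (X i j * Y k l) * comm (?G i j) (?G k l))"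
    unfolding rep_def comm_sum_left unfolding comm_sum_right scs ..
  also have "\<dots> = (\<Sum>i\<in>?I. \<Sum>j\<in>?I. \<Sum>k\<in>?I. \<Sum>l\<in>?I.
      (if k = j then sc (X i j * Y k l) * ?G i l else 0) - (if l = i then sc (X i j * Y k l) * ?G k j else 0))"
    by (intro sum.cong refl)
      (use gl_rel_gen[OF assms, of Lam] in \<open>auto simp: gl_rel_def right_diff_distrib\<close>)
  also have "\<dots> = (\<Sum>i\<in>?I. \<Sum>j\<in>?I. \<Sum>k\<in>?I. \<Sum>l\<in>?I. if k = j then sc (X i j * Y k l) * ?G i l else 0)
      - (\<Sum>i\<in>?I. \<Sum>j\<in>?I. \<Sum>k\<in>?I. \<Sum>l\<in>?I. if l = i then sc (X i j * Y k l) * ?G k j else 0)"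
    by (simp add: sum_subtractf)
  also have "(\<Sum>i\<in>?I. \<Sum>j\<in>?I. \<Sum>k\<in>?I. \<Sum>l\<in>?I. if k = j then sc (X i j * Y k l) * ?G i l else 0)
      = (\<Sum>i\<in>?I. \<Sum>j\<in>?I. \<Sum>l\<in>?I. \<Sum>k\<in>?I. if k = j then sc (X i j * Y k l) * ?G i l else 0)"
    by (intro sum.cong refl sum.swap)
  also have "\<dots> = (\<Sum>i\<in>?I. \<Sum>j\<in>?I. \<Sum>l\<in>?I. sc (X i j * Y j l) * ?G i l)"
    by (intro sum.cong refl) (simp add: sum.delta)
  also have "\<dots> = (\<Sum>i\<in>?I. \<Sum>l\<in>?I. \<Sum>j\<in>?I. sc (X i j * Y j l) * ?G i l)"
    by (intro sum.cong refl sum.swap)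
  also have "(\<Sum>i\<in>?I. \<Sum>j\<in>?I. \<Sum>k\<in>?I. \<Sum>l\<in>?I. if l = i then sc (X i j * Y k l) * ?G k j else 0)
      = (\<Sum>i\<in>?I. \<Sum>j\<in>?I. \<Sum>k\<in>?I. sc (X i j * Y k i) * ?G k j)"
    by (intro sum.cong refl) (simp add: sum.delta)
  also have "\<dots> = (\<Sum>i\<in>?I. \<Sum>k\<in>?I. \<Sum>j\<in>?I. sc (X i j * Y k i) * ?G k j)"
    by (intro sum.cong refl sum.swap)
  also have "\<dots> = (\<Sum>k\<in>?I. \<Sum>i\<in>?I. \<Sum>j\<in>?I. sc (X i j * Y k i) * ?G k j)"
    by (rule sum.swap)
  also have "\<dots> = (\<Sum>k\<in>?I. \<Sum>j\<in>?I. \<Sum>i\<in>?I. sc (X i j * Y k i) * ?G k j)"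
    by (intro sum.cong refl sum.swap)
  finally show ?thesis
    by (simp add: rep_def mbracket_def sc_diff sc_sum left_diff_distrib sum_subtractf
        sum_distrib_right mult.commute)
qed

text \<open>Summation by parts: both sides run over the pairs i \<le> p, once grouped by the
  diagonal entry and once by H_p.\<close>

lemma lamf_mu_of:
  assumes "1 \<le> n"
  shows "(\<Sum>i=1..n. X i i * mu_of n Lam i) = lamf n Lam X"
proof -
  have "(\<Sum>i=1..n. X i i * mu_of n Lam i) = (\<Sum>i=1..n. \<Sum>p=1..<n. if i \<le> p then X i i * Lam p else 0)"
  proof (intro sum.cong refl)
    fix i assume "i \<in> {1..n}"
    then have "{i..<n} = {p \<in> {1..<n}. i \<le> p}" by auto
    then show "X i i * mu_of n Lam i = (\<Sum>p=1..<n. if i \<le> p then X i i * Lam p else 0)"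
      by (simp add: mu_of_def sum.inter_filter[symmetric] sum_distrib_left)
  qed
  also have "\<dots> = (\<Sum>p=1..<n. \<Sum>i=1..n. if i \<le> p then X i i * Lam p else 0)"
    by (rule sum.swap)
  also have "\<dots> = (\<Sum>p=1..<n. (\<Sum>i=1..p. X i i) * Lam p)"
  proof (intro sum.cong refl)
    fix p assume "p \<in> {1..<n}"
    then have "{1..p} = {i \<in> {1..n}. i \<le> p}" by auto
    then show "(\<Sum>i=1..n. if i \<le> p then X i i * Lam p else 0) = (\<Sum>i=1..p. X i i) * Lam p"
      by (simp add: sum.inter_filter[symmetric] sum_distrib_right)
  qed
  also have "{1..<n} = {1..n-1}" using assms by auto
  finally show ?thesis by (simp add: lamf_def)
qed

lemma rep_borel_vac:
  assumes "1 \<le> n" "X \<in> borel n"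
  shows "app (rep n Lam X) vac = (\<lambda>a. lamf n Lam X * vac a)"
proof -
  have G: "app (sc (X i j) * gen n Lam i j) vac a = (if j = i then X i i * mu_of n Lam i * vac a else 0)"
    if "i \<in> {1..n}" "j \<in> {1..n}" for i j a
  proof (cases "i < j")
    case True
    with that assms(1) show ?thesis by (simp add: app_ops app_sc glV_upper_vac)
  next
    case False
    with that assms show ?thesis
      by (cases "i = j") (auto simp: app_ops app_sc glV_diag_vac borel_def)
  qed
  have "app (rep n Lam X) vac a = (\<Sum>i=1..n. \<Sum>j=1..n. if j = i then X i i * mu_of n Lam i * vac a else 0)" for a
    unfolding rep_def app_sum by (intro sum.cong refl G)
  then have "app (rep n Lam X) vac a = (\<Sum>i=1..n. X i i * mu_of n Lam i) * vac a" for a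
    by (simp add: sum.delta sum_distrib_right)
  then show ?thesis unfolding lamf_mu_of[OF assms(1)] by (rule ext)
qed

section \<open>The map from tensors to the model\<close>

fun act :: "nat \<Rightarrow> (nat \<Rightarrow> complex) \<Rightarrow> cmat list \<Rightarrow> pseries" where
  "act n Lam [] = vac"
| "act n Lam (X # w) = app (rep n Lam X) (act n Lam w)"

definition fsupp :: "vect \<Rightarrow> bool" where
  "fsupp f \<longleftrightarrow> finite {w. f w \<noteq> 0}"

text \<open>The type \<open>vect\<close> also contains infinitely supported functions, on which this
  sum is 0 by convention. Linearity therefore holds only under \<open>fsupp\<close>, which is
  carried along everywhere.\<close>

definition phi :: "nat \<Rightarrow> (nat \<Rightarrow> complex) \<Rightarrow> vect \<Rightarrow> pseries" where
  "phi n Lam f a = (\<Sum>w | f w \<noteq> 0. f w * act n Lam w a)"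

lemma phi_superset:
  assumes "finite W" "{w. f w \<noteq> 0} \<subseteq> W"
  shows "phi n Lam f a = (\<Sum>w\<in>W. f w * act n Lam w a)"
  unfolding phi_def by (rule sum.mono_neutral_left) (use assms in auto)

lemma fsupp_wd [simp]: "fsupp (wd w)"
  by (simp add: fsupp_def wd_def)

lemma phi_wd [simp]: "phi n Lam (wd w) = act n Lam w"
  by (rule ext) (simp add: phi_superset[of "{w}"] wd_def)

lemma fsupp_add [simp]: assumes "fsupp f" "fsupp g" shows "fsupp (\<lambda>t. f t + g t)"
  using finite_UnI[OF assms[unfolded fsupp_def]] unfolding fsupp_def
  by (rule rev_finite_subset) auto

lemma fsupp_diff [simp]: assumes "fsupp f" "fsupp g" shows "fsupp (\<lambda>t. f t - g t)"
  using finite_UnI[OF assms[unfolded fsupp_def]] unfolding fsupp_def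
  by (rule rev_finite_subset) auto

lemma fsupp_scale [simp]: assumes "fsupp f" shows "fsupp (\<lambda>t. c * f t)"
  using assms unfolding fsupp_def by (rule rev_finite_subset) auto

lemma phi_add: assumes "fsupp f" "fsupp g"
  shows "phi n Lam (\<lambda>t. f t + g t) = (\<lambda>a. phi n Lam f a + phi n Lam g a)"
proof
  fix a
  let ?W = "{w. f w \<noteq> 0} \<union> {w. g w \<noteq> 0}"
  have "finite ?W" using assms by (simp add: fsupp_def)
  then show "phi n Lam (\<lambda>t. f t + g t) a = phi n Lam f a + phi n Lam g a"
    by (subst (1 2 3) phi_superset[of ?W]) (auto simp: sum.distrib algebra_simps)
qed

lemma phi_scale: assumes "fsupp f"
  shows "phi n Lam (\<lambda>t. c * f t) = (\<lambda>a. c * phi n Lam f a)"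
proof
  fix a
  let ?W = "{w. f w \<noteq> 0}"
  have "finite ?W" using assms by (simp add: fsupp_def)
  then show "phi n Lam (\<lambda>t. c * f t) a = c * phi n Lam f a"
    by (subst (1 2) phi_superset[of ?W]) (auto simp: sum_distrib_left algebra_simps)
qed

lemma phi_diff: assumes "fsupp f" "fsupp g"
  shows "phi n Lam (\<lambda>t. f t - g t) = (\<lambda>a. phi n Lam f a - phi n Lam g a)"
  using phi_add[OF assms(1) fsupp_scale[OF assms(2), of "-1"]] phi_scale[OF assms(2), of n Lam "-1"]
  by simp

lemma fsupp_sum: assumes "\<And>i. i \<in> A \<Longrightarrow> fsupp (f i)"
  shows "fsupp (\<lambda>t. \<Sum>i\<in>A. f i t)"
  using assms
proof (induction A rule: infinite_finite_induct)
  case (insert i A)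
  then have "fsupp (\<lambda>t. f i t + (\<Sum>i\<in>A. f i t))" by simp
  with insert show ?case by simp
qed (auto simp: fsupp_def)

lemma phi_zero [simp]: "phi n Lam (\<lambda>t. 0) = (\<lambda>a. 0)"
  by (simp add: phi_def fun_eq_iff)

lemma phi_sum: assumes "\<And>i. i \<in> A \<Longrightarrow> fsupp (f i)"
  shows "phi n Lam (\<lambda>t. \<Sum>i\<in>A. f i t) = (\<lambda>a. \<Sum>i\<in>A. phi n Lam (f i) a)"
  using assms
proof (induction A rule: infinite_finite_induct)
  case (insert i A)
  then show ?case by (simp add: phi_add fsupp_sum)
qed auto

lemma app_cong_sum:
  "app A (\<lambda>a. \<Sum>w\<in>W. c w * g w a) = (\<lambda>a. \<Sum>w\<in>W. c w * app A (g w) a)"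
  by (induction W rule: infinite_finite_induct) (simp_all add: app_add app_scale)

lemma lmul_wd [simp]: "lmul X (wd w) = wd (X # w)"
  by (auto simp: lmul_def wd_def fun_eq_iff split: list.split)

lemma supp_lmul: "{w. lmul X f w \<noteq> 0} = (#) X ` {w. f w \<noteq> 0}"
proof -
  have "w \<in> (#) X ` {w. f w \<noteq> 0}" if "lmul X f w \<noteq> 0" for w
    using that by (cases w) (auto simp: lmul_def split: if_splits)
  then show ?thesis by (auto simp: lmul_def)
qed

lemma fsupp_lmul [simp]: "fsupp f \<Longrightarrow> fsupp (lmul X f)"
  by (simp add: fsupp_def supp_lmul)

lemma phi_lmul: assumes "fsupp f"
  shows "phi n Lam (lmul X f) = app (rep n Lam X) (phi n Lam f)"
proof -
  have "phi n Lam (lmul X f) a = (\<Sum>w | f w \<noteq> 0. f w * act n Lam (X # w) a)" for a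
    unfolding phi_def supp_lmul by (subst sum.reindex) (auto simp: lmul_def)
  then show ?thesis
    by (simp add: phi_def[abs_def] app_cong_sum fun_eq_iff)
qed

text \<open>The relations sit between a prefix and a suffix. The operator of a word, unlike its
  value on \<open>vac\<close>, is multiplicative and can be split at that place.\<close>

fun acts :: "nat \<Rightarrow> (nat \<Rightarrow> complex) \<Rightarrow> cmat list \<Rightarrow> lop" where
  "acts n Lam [] = 1"
| "acts n Lam (X # w) = rep n Lam X * acts n Lam w"

lemma acts_append: "acts n Lam (u @ w) = acts n Lam u * acts n Lam w"
  by (induction u) (simp_all add: mult.assoc)

lemma act_acts: "act n Lam w = app (acts n Lam w) vac"
  by (induction w) (simp_all add: app_ops)

text \<open>The map descends to the Verma module: \<open>rep\<close> is linear and respects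
  brackets, which kills the relations of U(g), and \<open>vac\<close> is a highest weight vector of
  weight lambda, which kills the others.\<close>

lemma Mrels_kernel:
  assumes "1 \<le> n" "f \<in> Mrels n Lam"
  shows "fsupp f \<and> phi n Lam f = (\<lambda>_. 0)"
proof -
  consider (lin) u w X Y c where
      "f = (\<lambda>t. wd (u @ [madd X (msmult c Y)] @ w) t - wd (u @ [X] @ w) t - c * wd (u @ [Y] @ w) t)"
    | (com) u w X Y where
      "f = (\<lambda>t. wd (u @ [X, Y] @ w) t - wd (u @ [Y, X] @ w) t - wd (u @ [mbracket n X Y] @ w) t)"
    | (vac) u X where "X \<in> borel n" "f = (\<lambda>t. wd (u @ [X]) t - lamf n Lam X * wd u t)"
    using assms(2) unfolding Mrels_def Urels_def by blast
  then show ?thesis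
  proof cases
    case lin
    have "acts n Lam (u @ [madd X (msmult c Y)] @ w)
        = acts n Lam (u @ [X] @ w) + sc c * acts n Lam (u @ [Y] @ w)"
      using sc_mult_left[of "acts n Lam u" c]
      by (simp add: acts_append rep_linear algebra_simps flip: mult.assoc)
    with lin show ?thesis
      by (simp del: act.simps add: phi_diff phi_scale act_acts app_ops app_sc)
  next
    case com
    have "acts n Lam (u @ [mbracket n X Y] @ w)
        = acts n Lam (u @ [X, Y] @ w) - acts n Lam (u @ [Y, X] @ w)"
      by (simp add: acts_append rep_bracket[OF assms(1)] comm_def algebra_simps)
    with com show ?thesis
      by (simp del: act.simps add: phi_diff phi_scale act_acts app_ops)
  next
    case vac
    then show ?thesis
      by (simp del: act.simps add: phi_diff phi_scale act_acts acts_append app_ops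
          rep_borel_vac[OF assms(1)] app_scale)
  qed
qed

text \<open>This is the test for non-membership: an element with nonzero image is outside the
  ideal.\<close>

lemma cspan_kernel:
  assumes "1 \<le> n" "f \<in> cspan (Mrels n Lam)"
  shows "fsupp f \<and> phi n Lam f = (\<lambda>_. 0)"
  using assms(2)
proof induction
  case zero
  then show ?case by (simp add: fsupp_def)
next
  case (base f)
  then show ?case using Mrels_kernel[OF assms(1)] by blast
qed (simp_all add: phi_add phi_scale)

section \<open>Ordered words and monomials\<close>

lemma cspan_mono: "R \<subseteq> R' \<Longrightarrow> cspan R \<subseteq> cspan R'"
proof
  fix f assume R: "R \<subseteq> R'" and "f \<in> cspan R"
  from this(2) show "f \<in> cspan R'"
    by induction (use R in \<open>auto intro: cspan.intros\<close>)
qed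

lemma cspan_diff: assumes "f \<in> cspan R" "g \<in> cspan R" shows "(\<lambda>t. f t - g t) \<in> cspan R"
  using cspan.add[OF assms(1) cspan.smult[OF assms(2), of "-1"]] by simp

lemma cspan_sum: "(\<And>i. i \<in> A \<Longrightarrow> f i \<in> cspan R) \<Longrightarrow> (\<lambda>t. \<Sum>i\<in>A. f i t) \<in> cspan R"
  by (induction A rule: infinite_finite_induct) (auto intro: cspan.intros)

text \<open>Separates the part in the ideal from a finite combination of ordered words, whose
  coefficients can then be compared. When two such combinations are added, their coefficients are
  first extended by 0 to the union of the index sets.\<close>

lemma cspan_un_decomp:
  assumes "f \<in> cspan (A \<union> g ` B)"
  shows "\<exists>h F c. h \<in> cspan A \<and> finite F \<and> F \<subseteq> B \<and> f = (\<lambda>t. h t + (\<Sum>b\<in>F. c b * g b t))"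
  using assms
proof induction
  case zero
  show ?case by (rule exI[of _ "\<lambda>_. 0"], rule exI[of _ "{}"]) (auto intro: cspan.zero)
next
  case (base f)
  then show ?case
  proof
    assume "f \<in> A"
    then show ?case
      by (intro exI[of _ f] exI[of _ "{}"]) (auto intro: cspan.base)
  next
    assume "f \<in> g ` B"
    then obtain b where "b \<in> B" "f = g b" by auto
    then show ?case
      by (intro exI[of _ "\<lambda>_. 0"] exI[of _ "{b}"] exI[of _ "\<lambda>_. 1"]) (auto intro: cspan.zero)
  qed
next
  case (add f f')
  then obtain h F c h' F' c' where
    f: "h \<in> cspan A" "finite F" "F \<subseteq> B" "f = (\<lambda>t. h t + (\<Sum>b\<in>F. c b * g b t))" and
    f': "h' \<in> cspan A" "finite F'" "F' \<subseteq> B" "f' = (\<lambda>t. h' t + (\<Sum>b\<in>F'. c' b * g b t))"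
    by blast
  have 1: "(\<Sum>b\<in>F. c b * g b t) = (\<Sum>b\<in>F \<union> F'. (if b \<in> F then c b else 0) * g b t)" for t
    by (rule sum.mono_neutral_cong_left) (use f f' in auto)
  have 2: "(\<Sum>b\<in>F'. c' b * g b t) = (\<Sum>b\<in>F \<union> F'. (if b \<in> F' then c' b else 0) * g b t)" for t
    by (rule sum.mono_neutral_cong_left) (use f f' in auto)
  have "(\<lambda>t. f t + f' t) = (\<lambda>t. (h t + h' t) + (\<Sum>b\<in>F \<union> F'.
      ((if b \<in> F then c b else 0) + (if b \<in> F' then c' b else 0)) * g b t))"
    unfolding f(4) f'(4) 1 2 by (simp add: sum.distrib distrib_right add_ac)
  then show ?case
    using f f' by (intro exI[of _ "\<lambda>t. h t + h' t"] exI[of _ "F \<union> F'"]) (auto intro: cspan.add)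
next
  case (smult f c0)
  then obtain h F c where
    f: "h \<in> cspan A" "finite F" "F \<subseteq> B" "f = (\<lambda>t. h t + (\<Sum>b\<in>F. c b * g b t))"
    by blast
  have "(\<lambda>t. c0 * f t) = (\<lambda>t. c0 * h t + (\<Sum>b\<in>F. (c0 * c b) * g b t))"
    unfolding f(4) by (simp add: distrib_left sum_distrib_left mult.assoc)
  then show ?case
    using f cspan.smult[OF f(1), of c0]
    by (intro exI[of _ "\<lambda>t. c0 * h t"] exI[of _ F] exI[of _ "\<lambda>b. c0 * c b"]) auto
qed

lemma mbracket_sl: assumes "X \<in> sl n" "Y \<in> sl n" shows "mbracket n X Y \<in> sl n"
proof -
  have "(\<Sum>i=1..n. \<Sum>t=1..n. Y i t * X t i) = (\<Sum>t=1..n. \<Sum>i=1..n. Y i t * X t i)"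
    by (rule sum.swap)
  then have "(\<Sum>i=1..n. mbracket n X Y i i) = 0"
    by (simp add: mbracket_def sum_subtractf mult.commute)
  moreover have "mbracket n X Y i j = 0" if "\<not> (1 \<le> i \<and> i \<le> n \<and> 1 \<le> j \<and> j \<le> n)" for i j
  proof -
    have "(\<forall>t. X i t = 0 \<and> Y i t = 0) \<or> (\<forall>t. X t j = 0 \<and> Y t j = 0)"
      using that assms by (auto simp: sl_def)
    then show ?thesis by (auto simp: mbracket_def)
  qed
  ultimately show ?thesis by (simp add: sl_def)
qed

lemma Emat_sl: assumes "1 \<le> i" "i \<le> n" "1 \<le> j" "j \<le> n" "i \<noteq> j" shows "Emat i j \<in> sl n"
  using assms by (auto simp: sl_def Emat_def intro!: sum.neutral)

lemma borel_sl: "X \<in> borel n \<Longrightarrow> X \<in> sl n"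
  by (simp add: borel_def)

lemma comb_sl: "X \<in> sl n \<Longrightarrow> Y \<in> sl n \<Longrightarrow> madd X (msmult c Y) \<in> sl n"
  by (auto simp: sl_def madd_def msmult_def sum.distrib simp flip: sum_distrib_left)

lemma lmul_Mrels: assumes "X \<in> sl n" "f \<in> Mrels n Lam" shows "lmul X f \<in> Mrels n Lam"
proof -
  have lm: "lmul X (\<lambda>t. f t - g t) = (\<lambda>t. lmul X f t - lmul X g t)"
     "lmul X (\<lambda>t. c * f t) = (\<lambda>t. c * lmul X f t)" for f g c
    by (auto simp: lmul_def fun_eq_iff split: list.split)
  consider (lin) u w Y Z c where "u \<in> words n" "w \<in> words n" "Y \<in> sl n" "Z \<in> sl n"
      "f = (\<lambda>t. wd (u @ [madd Y (msmult c Z)] @ w) t - wd (u @ [Y] @ w) t - c * wd (u @ [Z] @ w) t)"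
    | (com) u w Y Z where "u \<in> words n" "w \<in> words n" "Y \<in> sl n" "Z \<in> sl n"
      "f = (\<lambda>t. wd (u @ [Y, Z] @ w) t - wd (u @ [Z, Y] @ w) t - wd (u @ [mbracket n Y Z] @ w) t)"
    | (vac) u Y where "u \<in> words n" "Y \<in> borel n" "f = (\<lambda>t. wd (u @ [Y]) t - lamf n Lam Y * wd u t)"
    using assms(2) unfolding Mrels_def Urels_def by blast
  then show ?thesis
  proof cases
    case lin
    then have "X # u \<in> words n" using assms(1) by (simp add: words_def)
    moreover have "lmul X f = (\<lambda>t. wd ((X # u) @ [madd Y (msmult c Z)] @ w) t
        - wd ((X # u) @ [Y] @ w) t - c * wd ((X # u) @ [Z] @ w) t)"
      using lin by (simp add: lm)
    ultimately show ?thesis using lin unfolding Mrels_def Urels_def by blast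
  next
    case com
    then have "X # u \<in> words n" using assms(1) by (simp add: words_def)
    moreover have "lmul X f = (\<lambda>t. wd ((X # u) @ [Y, Z] @ w) t
        - wd ((X # u) @ [Z, Y] @ w) t - wd ((X # u) @ [mbracket n Y Z] @ w) t)"
      using com by (simp add: lm)
    ultimately show ?thesis using com unfolding Mrels_def Urels_def by blast
  next
    case vac
    then have "X # u \<in> words n" using assms(1) by (simp add: words_def)
    moreover have "lmul X f = (\<lambda>t. wd ((X # u) @ [Y]) t - lamf n Lam Y * wd (X # u) t)"
      using vac by (simp add: lm)
    ultimately show ?thesis using vac unfolding Mrels_def by blast
  qed
qed

lemma lmul_cspan:
  assumes "f \<in> cspan R" "\<And>g. g \<in> R \<Longrightarrow> lmul X g \<in> cspan R'"
  shows "lmul X f \<in> cspan R'"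
  using assms(1)
proof induction
  case zero
  have "lmul X (\<lambda>_. 0) = (\<lambda>_. 0)" by (auto simp: lmul_def fun_eq_iff split: list.split)
  then show ?case by (simp add: cspan.zero)
next
  case (add f g)
  have "lmul X (\<lambda>u. f u + g u) = (\<lambda>u. lmul X f u + lmul X g u)"
    by (auto simp: lmul_def fun_eq_iff split: list.split)
  with add show ?case by (simp add: cspan.add)
next
  case (smult f c)
  have "lmul X (\<lambda>u. c * f u) = (\<lambda>u. c * lmul X f u)"
    by (auto simp: lmul_def fun_eq_iff split: list.split)
  with smult show ?case by (simp add: cspan.smult)
qed (use assms(2) in auto)

section \<open>The order of the factors of E^a and the images of the ordered words\<close>

definition positions :: "nat \<Rightarrow> (nat \<times> nat) list" where
  "positions n = concat (map (\<lambda>i. map (Pair i) [1..<i]) [2..<n+1])"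

abbreviation letters :: "(nat \<Rightarrow> nat \<Rightarrow> nat) \<Rightarrow> nat \<times> nat \<Rightarrow> cmat list" where
  "letters a p \<equiv> replicate (a (fst p) (snd p)) (Emat (fst p) (snd p))"

lemma Eword_positions: "Eword n a = concat (map (letters a) (positions n))"
proof -
  have concat_concat: "concat (concat xss) = concat (map concat xss)" for xss :: "cmat list list list"
    by (induction xss) simp_all
  show ?thesis
    by (simp add: Eword_def positions_def map_concat comp_def concat_concat)
qed

lemma set_positions: "set (positions n) = {(i, j). 1 \<le> j \<and> j < i \<and> i \<le> n}"
proof -
  have "(i, j) \<in> set (positions n) \<longleftrightarrow> 1 \<le> j \<and> j < i \<and> i \<le> n" for i j
    by (cases "i = n") (auto simp: positions_def intro!: exI[of _ i])
  then show ?thesis by auto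
qed

lemma positions_Suc: "1 \<le> n \<Longrightarrow> positions (Suc n) = positions n @ map (Pair (Suc n)) [1..<Suc n]"
  by (simp add: positions_def)

lemma distinct_positions: "distinct (positions n)"
proof (induction n)
  case (Suc n)
  then show ?case
    by (cases "1 \<le> n") (auto simp: positions_Suc set_positions distinct_map inj_on_def, simp add: positions_def)
qed (simp add: positions_def)

lemma sorted_positions: "sorted_wrt (\<lambda>p q. fst p \<le> fst q) (positions n)"
proof (induction n)
  case (Suc n)
  then show ?case
    by (cases "1 \<le> n") (auto simp: positions_Suc set_positions sorted_wrt_append sorted_wrt_map, simp add: positions_def)
qed (simp add: positions_def)

definition mon :: "(nat \<times> nat \<Rightarrow> nat) \<Rightarrow> pseries" where
  "mon b a = (if a = b then 1 else 0)"

lemma eq_fun_upd_Suc_iff: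
  fixes a b :: "'a \<Rightarrow> nat"
  shows "a = b(p := b p + 1) \<longleftrightarrow> a p \<noteq> 0 \<and> a(p := a p - 1) = b"
  by (auto simp: fun_eq_iff)

lemma mul_mon: "app (mul_var p) (mon b) = mon (b(p := b p + 1))"
  by (rule ext) (simp add: mul_var.rep_eq mon_def eq_fun_upd_Suc_iff del: One_nat_def)

lemma der_mon: assumes "b p = 0" shows "app (der_var p) (mon b) = (\<lambda>_. 0)"
proof
  fix a :: "nat \<times> nat \<Rightarrow> nat"
  have "a(p := a p + 1) \<noteq> b" using assms by (metis Suc_eq_plus1 fun_upd_same nat.distinct(1))
  then show "app (der_var p) (mon b) a = 0" by (simp add: der_var.rep_eq mon_def)
qed

text \<open>In the ordered words the letters to the right of \<open>E_{i,j}\<close> come from rows \<open>\<ge> i\<close>, so row \<open>j\<close> of the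
  exponent is still zero and the derivative terms of \<open>E_{i,j}\<close> vanish.\<close>

lemma gen_lower_mon:
  assumes "1 \<le> j" "j < i" "i \<le> n" "\<And>c. b (j, c) = 0"
  shows "app (gen n Lam i j) (mon b) = mon (b((i, j) := b (i, j) + 1))"
  using assms by (subst glV_lower) (auto simp: app_ops app_sum mul_mon der_mon fun_eq_iff)

lemma act_replicate:
  assumes "1 \<le> j" "j < i" "i \<le> n" "\<And>c. b (j, c) = 0" "act n Lam w = mon b"
  shows "act n Lam (replicate m (Emat i j) @ w) = mon (b((i, j) := b (i, j) + m))"
proof (induction m)
  case 0
  then show ?case using assms by simp
next
  case (Suc m)
  have "act n Lam (replicate (Suc m) (Emat i j) @ w)
      = app (gen n Lam i j) (mon (b((i, j) := b (i, j) + m)))"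
    using assms(1-3) by (simp add: rep_Emat flip: Suc)
  also have "\<dots> = mon (b((i, j) := b (i, j) + Suc m))"
    using assms by (subst gen_lower_mon) auto
  finally show ?case .
qed

lemma act_letters:
  assumes "distinct L" "sorted_wrt (\<lambda>p q. fst p \<le> fst q) L" "set L \<subseteq> set (positions n)"
  shows "act n Lam (concat (map (letters a) L)) = mon (\<lambda>p. if p \<in> set L then a (fst p) (snd p) else 0)"
  using assms
proof (induction L)
  case Nil
  then show ?case by (auto simp: vac_def mon_def)
next
  case (Cons p L)
  obtain i j where p: "p = (i, j)" by force
  let ?b = "\<lambda>p. if p \<in> set L then a (fst p) (snd p) else 0"
  have "act n Lam (replicate (a i j) (Emat i j) @ concat (map (letters a) L))
      = mon (?b((i, j) := ?b (i, j) + a i j))"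
    using Cons p by (intro act_replicate) (auto simp: set_positions)
  also have "?b((i, j) := ?b (i, j) + a i j) = (\<lambda>q. if q \<in> set (p # L) then a (fst q) (snd q) else 0)"
    using Cons.prems p by (auto simp: fun_eq_iff)
  finally show ?case using p by simp
qed

lemma act_Eword:
  assumes "a \<in> GammaSet n"
  shows "act n Lam (Eword n a) = mon (case_prod a)"
proof -
  have "(\<lambda>p. if p \<in> set (positions n) then a (fst p) (snd p) else 0) = case_prod a"
    using assms by (auto simp: fun_eq_iff set_positions GammaSet_def) 
  then show ?thesis
    using act_letters[OF distinct_positions sorted_positions order_refl, of n Lam a]
    by (simp add: Eword_positions)
qed

lemma mset_Eword: "mset (Eword n a)
    = (\<Sum>p\<in>set (positions n). replicate_mset (a (fst p) (snd p)) (Emat (fst p) (snd p)))"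
  by (simp add: Eword_positions mset_concat comp_def sum_list_distinct_conv_sum_set distinct_positions)

lemma set_Eword: "set (Eword n a) \<subseteq> sl n"
  by (auto simp: Eword_positions set_positions intro!: Emat_sl)

definition inc :: "(nat \<Rightarrow> nat \<Rightarrow> nat) \<Rightarrow> nat \<Rightarrow> nat \<Rightarrow> nat \<Rightarrow> nat \<Rightarrow> nat" where
  "inc a p q = (\<lambda>i j. a i j + (if i = p \<and> j = q then 1 else 0))"

lemma inc_GammaSet_iff:
  assumes "1 \<le> q" "q < p" "p \<le> n"
  shows "inc a p q \<in> GammaSet n \<longleftrightarrow> a \<in> GammaSet n"
proof -
  have "inc a p q i j \<noteq> 0 \<longleftrightarrow> a i j \<noteq> 0 \<or> (i = p \<and> j = q)" for i j
    by (auto simp: inc_def)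
  then have "inc a p q \<in> GammaSet n \<longleftrightarrow> (\<forall>i j. a i j \<noteq> 0 \<or> (i = p \<and> j = q) \<longrightarrow> 1 \<le> j \<and> j < i \<and> i \<le> n)"
    unfolding GammaSet_def by simp
  also have "\<dots> \<longleftrightarrow> a \<in> GammaSet n"
    using assms unfolding GammaSet_def mem_Collect_eq by metis
  finally show ?thesis .
qed

text \<open>Multiplying E^a by one lower letter gives a permutation of another ordered word, so in
  the spanning argument only reordering remains.\<close>

lemma mset_Eword_inc:
  assumes "(i, j) \<in> set (positions n)"
  shows "mset (Eword n (inc a i j)) = mset (Emat i j # Eword n a)"
proof -
  let ?f = "\<lambda>a p. replicate_mset (a (fst p) (snd p)) (Emat (fst p) (snd p))"
  have "(\<Sum>p\<in>set (positions n) - {(i, j)}. ?f (inc a i j) p)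
     = (\<Sum>p\<in>set (positions n) - {(i, j)}. ?f a p)"
    by (intro sum.cong refl) (auto simp: inc_def)
  then show ?thesis
    unfolding mset.simps mset_Eword by (simp add: sum.remove[OF _ assms] inc_def)
qed

section \<open>Ordered words span modulo the ideal\<close>

text \<open>The length bound is the usual filtration of U(g): exchanging two letters costs a
  bracket, and the corresponding word is shorter by one.\<close>

definition pbw_span :: "nat \<Rightarrow> (nat \<Rightarrow> complex) \<Rightarrow> nat \<Rightarrow> vect set" where
  "pbw_span n Lam d = cspan (Mrels n Lam \<union>
     (\<lambda>a. wd (Eword n a)) ` {a \<in> GammaSet n. length (Eword n a) \<le> d})"

lemma pbw_span_mono: "d \<le> d' \<Longrightarrow> pbw_span n Lam d \<subseteq> pbw_span n Lam d'"
  unfolding pbw_span_def by (rule cspan_mono) auto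

lemma pbw_span_rel: "f \<in> Mrels n Lam \<Longrightarrow> f \<in> pbw_span n Lam d"
  by (simp add: pbw_span_def cspan.base)

lemma pbw_span_add: "f \<in> pbw_span n Lam d \<Longrightarrow> g \<in> pbw_span n Lam d \<Longrightarrow> (\<lambda>t. f t + g t) \<in> pbw_span n Lam d"
  and pbw_span_scale: "f \<in> pbw_span n Lam d \<Longrightarrow> (\<lambda>t. c * f t) \<in> pbw_span n Lam d"
  by (simp_all add: pbw_span_def cspan.add cspan.smult)

lemma Urels_lin: "u \<in> words n \<Longrightarrow> w \<in> words n \<Longrightarrow> X \<in> sl n \<Longrightarrow> Y \<in> sl n \<Longrightarrow>
    (\<lambda>t. wd (u @ [madd X (msmult c Y)] @ w) t - wd (u @ [X] @ w) t - c * wd (u @ [Y] @ w) t) \<in> Urels n"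
  unfolding Urels_def by blast

lemma Urels_com: "u \<in> words n \<Longrightarrow> w \<in> words n \<Longrightarrow> X \<in> sl n \<Longrightarrow> Y \<in> sl n \<Longrightarrow>
    (\<lambda>t. wd (u @ [X, Y] @ w) t - wd (u @ [Y, X] @ w) t - wd (u @ [mbracket n X Y] @ w) t) \<in> Urels n"
  unfolding Urels_def by blast

lemma Mrels_vac: "u \<in> words n \<Longrightarrow> X \<in> borel n \<Longrightarrow>
    (\<lambda>t. wd (u @ [X]) t - lamf n Lam X * wd u t) \<in> Mrels n Lam"
  unfolding Mrels_def by blast

lemma Urels_Mrels: "f \<in> Urels n \<Longrightarrow> f \<in> Mrels n Lam"
  unfolding Mrels_def by blast

text \<open>The bracket term has length at most d and is covered by \<open>short\<close>. The bounds
  d and d' are separate because shorter words are known to be spanned while the ordered words aimed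
  at may be longer.\<close>

lemma pbw_span_swap:
  assumes short: "\<And>w. w \<in> words n \<Longrightarrow> length w \<le> d \<Longrightarrow> wd w \<in> pbw_span n Lam d'"
    and "set u \<subseteq> sl n" "set w \<subseteq> sl n" "X \<in> sl n" "Y \<in> sl n" "length (u @ [X, Y] @ w) \<le> Suc d"
    and mem: "wd (u @ [X, Y] @ w) \<in> pbw_span n Lam d'"
  shows "wd (u @ [Y, X] @ w) \<in> pbw_span n Lam d'"
proof -
  let ?r = "\<lambda>t. wd (u @ [Y, X] @ w) t - wd (u @ [X, Y] @ w) t - wd (u @ [mbracket n Y X] @ w) t"
  have "u \<in> words n" "w \<in> words n" using assms by (auto simp: words_def)
  then have "?r \<in> pbw_span n Lam d'"
    using assms by (intro pbw_span_rel Urels_Mrels Urels_com) auto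
  moreover have "u @ [mbracket n Y X] @ w \<in> words n"
    using assms by (auto simp: words_def mbracket_sl)
  then have "wd (u @ [mbracket n Y X] @ w) \<in> pbw_span n Lam d'"
    by (rule short) (use assms in simp)
  ultimately have "(\<lambda>t. (?r t + wd (u @ [X, Y] @ w) t) + wd (u @ [mbracket n Y X] @ w) t) \<in> pbw_span n Lam d'"
    using mem by (intro pbw_span_add) auto
  then show ?thesis by simp
qed

lemma pbw_span_move:
  assumes short: "\<And>w. w \<in> words n \<Longrightarrow> length w \<le> d \<Longrightarrow> wd w \<in> pbw_span n Lam d'"
    and "set u \<subseteq> sl n" "set y \<subseteq> sl n" "set w \<subseteq> sl n" "X \<in> sl n" "length (u @ y @ [X] @ w) \<le> Suc d"
    and "wd (u @ y @ [X] @ w) \<in> pbw_span n Lam d'"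
  shows "wd (u @ [X] @ y @ w) \<in> pbw_span n Lam d'"
  using assms(2-)
proof (induction y arbitrary: w rule: rev_induct)
  case Nil
  then show ?case by simp
next
  case (snoc Y y)
  have "wd ((u @ y) @ [X, Y] @ w) \<in> pbw_span n Lam d'"
    by (rule pbw_span_swap[OF short]) (use snoc.prems in auto)
  then have "wd (u @ [X] @ y @ ([Y] @ w)) \<in> pbw_span n Lam d'"
    by (intro snoc.IH) (use snoc.prems in auto)
  then show ?case by simp
qed

text \<open>Sorting by insertion: the head of w is located in w', moved to its front and absorbed
  into the prefix u, which is why u is general in the induction.\<close>

lemma pbw_span_mset:
  assumes short: "\<And>w. w \<in> words n \<Longrightarrow> length w \<le> d \<Longrightarrow> wd w \<in> pbw_span n Lam d'"
    and "set u \<subseteq> sl n" "set w \<subseteq> sl n" "length (u @ w) \<le> Suc d" "mset w = mset w'"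
    and "wd (u @ w') \<in> pbw_span n Lam d'"
  shows "wd (u @ w) \<in> pbw_span n Lam d'"
  using assms(2-)
proof (induction w arbitrary: u w')
  case Nil
  then show ?case by simp
next
  case (Cons X w)
  then have "X \<in> set w'" by (metis list.set_intros(1) set_mset_mset)
  then obtain y z where w': "w' = y @ X # z" by (meson split_list)
  have sets: "set (y @ X # z) = set (X # w)"
    using Cons.prems(4) w' by (metis set_mset_mset)
  have len: "length (y @ X # z) = length (X # w)"
    using Cons.prems(4) w' by (metis size_mset)
  have "wd (u @ [X] @ y @ z) \<in> pbw_span n Lam d'"
    by (rule pbw_span_move[OF short]) (use Cons.prems w' sets len in auto)
  then have "wd ((u @ [X]) @ w) \<in> pbw_span n Lam d'"
    by (intro Cons.IH[of "u @ [X]" "y @ z"]) (use Cons.prems w' in auto)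
  then show ?case by simp
qed

lemma pbw_span_letter:
  assumes "set w \<subseteq> sl n" "X \<in> sl n"
    and bor: "\<And>B. B \<in> borel n \<Longrightarrow> wd (B # w) \<in> pbw_span n Lam d"
    and low: "\<And>i j. (i, j) \<in> set (positions n) \<Longrightarrow> wd (Emat i j # w) \<in> pbw_span n Lam d"
  shows "wd (X # w) \<in> pbw_span n Lam d"
proof -
  \<comment> \<open>Of the strictly lower entries of X only those at positions in F are kept. For F
    empty the matrix lies in the Borel subalgebra, for all positions it is X, and one more position
    costs one linearity relation.\<close>
  let ?B = "\<lambda>F i j. if j < i \<and> (i, j) \<notin> F then 0 else X i j"
  have "?B F \<in> sl n \<and> wd (?B F # w) \<in> pbw_span n Lam d" if "F \<subseteq> set (positions n)" for F
    using finite_subset[OF that finite_set] that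
  proof induction
    case empty
    have "?B {} \<in> borel n" using assms(2) by (auto simp: borel_def sl_def)
    then show ?case using bor borel_sl by simp
  next
    case (insert p F)
    obtain i j where p: "p = (i, j)" by force
    then have ij: "(i, j) \<in> set (positions n)" "1 \<le> j" "j < i" "i \<le> n"
      using insert.prems by (auto simp: set_positions)
    then have E: "Emat i j \<in> sl n" by (intro Emat_sl) auto
    have eq: "?B (insert p F) = madd (?B F) (msmult (X i j) (Emat i j))"
      using insert.hyps p ij by (auto simp: fun_eq_iff madd_def msmult_def Emat_def)
    have IH: "?B F \<in> sl n" "wd (?B F # w) \<in> pbw_span n Lam d" using insert by auto
    let ?r = "\<lambda>t. wd ([] @ [madd (?B F) (msmult (X i j) (Emat i j))] @ w) t - wd ([] @ [?B F] @ w) t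
        - X i j * wd ([] @ [Emat i j] @ w) t"
    have "[] \<in> words n" "w \<in> words n" using assms by (auto simp: words_def)
    then have "?r \<in> pbw_span n Lam d"
      by (intro pbw_span_rel Urels_Mrels Urels_lin IH(1) E)
    then have "(\<lambda>t. (?r t + wd (?B F # w) t) + X i j * wd (Emat i j # w) t) \<in> pbw_span n Lam d"
      by (rule pbw_span_add[OF pbw_span_add pbw_span_scale]) (intro IH low ij)+
    then have "wd (?B (insert p F) # w) \<in> pbw_span n Lam d"
      unfolding eq by simp
    then show ?case using comb_sl[OF IH(1) E, of "X i j"] unfolding eq by blast
  qed
  from this[OF order_refl] have all: "wd (?B (set (positions n)) # w) \<in> pbw_span n Lam d" by blast
  have eq: "?B (set (positions n)) = X"
  proof (intro ext)
    fix i j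
    show "?B (set (positions n)) i j = X i j"
      using assms(2) by (cases "j < i \<and> (i, j) \<notin> set (positions n)") (auto simp: set_positions sl_def)
  qed
  show ?thesis using all unfolding eq .
qed

text \<open>By linearity the tail of the word may be taken to be ordered, and its head to be a Borel
  element or a lower matrix unit. A Borel element is moved to the right end, where it becomes the
  scalar lambda(B); a lower unit is moved to its place in the order.\<close>

lemma word_in_pbw_span:
  "w \<in> words n \<Longrightarrow> length w \<le> d \<Longrightarrow> wd w \<in> pbw_span n Lam d"
proof (induction d arbitrary: w)
  case 0
  have "(\<lambda>_ _. 0) \<in> GammaSet n" "Eword n (\<lambda>_ _. 0) = []"
    by (simp_all add: GammaSet_def Eword_positions)
  then have "wd [] \<in> pbw_span n Lam 0"
    unfolding pbw_span_def by (intro cspan.base UnI2 image_eqI[of _ _ "\<lambda>_ _. 0"]) auto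
  with 0 show ?case by simp
next
  case (Suc d)
  note short = subsetD[OF pbw_span_mono[of d "Suc d" n Lam] Suc.IH, OF le_SucI[OF order_refl]]
  show ?case
  proof (cases w)
    case Nil
    then show ?thesis using short Suc.prems by simp
  next
    case (Cons X w')
    then have X: "X \<in> sl n" and w': "w' \<in> words n" "length w' \<le> d"
      using Suc.prems by (auto simp: words_def)
    have "lmul X (wd w') \<in> cspan (Mrels n Lam \<union>
       (\<lambda>a. wd (Eword n a)) ` {a \<in> GammaSet n. length (Eword n a) \<le> Suc d})"
    proof (rule lmul_cspan[OF Suc.IH[OF w', unfolded pbw_span_def]], fold pbw_span_def)
      fix g assume "g \<in> Mrels n Lam \<union> (\<lambda>a. wd (Eword n a)) ` {a \<in> GammaSet n. length (Eword n a) \<le> d}"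
      then consider "g \<in> Mrels n Lam" | a where "a \<in> GammaSet n" "length (Eword n a) \<le> d" "g = wd (Eword n a)"
        by auto
      then show "lmul X g \<in> pbw_span n Lam (Suc d)"
      proof cases
        case 1
        then show ?thesis using X by (simp add: lmul_Mrels pbw_span_rel)
      next
        case 2
        have "wd (X # Eword n a) \<in> pbw_span n Lam (Suc d)"
        proof (rule pbw_span_letter[OF set_Eword X])
          fix B assume B: "B \<in> borel n"
          have a: "wd (Eword n a) \<in> pbw_span n Lam (Suc d)"
            using 2 by (intro short) (auto simp: words_def set_Eword)
          let ?r = "\<lambda>t. wd (Eword n a @ [B]) t - lamf n Lam B * wd (Eword n a) t"
          have "Eword n a \<in> words n" by (simp add: words_def set_Eword)
          then have "?r \<in> pbw_span n Lam (Suc d)" by (intro pbw_span_rel Mrels_vac B)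
          from pbw_span_add[OF this pbw_span_scale[OF a]]
          have "(\<lambda>t. ?r t + lamf n Lam B * wd (Eword n a) t) \<in> pbw_span n Lam (Suc d)" .
          then have "wd ([] @ Eword n a @ [B]) \<in> pbw_span n Lam (Suc d)" by simp
          from pbw_span_mset[OF short _ _ _ _ this, of d "B # Eword n a"]
          show "wd (B # Eword n a) \<in> pbw_span n Lam (Suc d)"
            using 2 set_Eword[of n a] borel_sl[OF B] by simp
        next
          fix i j assume ij: "(i, j) \<in> set (positions n)"
          let ?a = "inc a i j"
          have ms: "mset (Emat i j # Eword n a) = mset (Eword n ?a)"
            by (rule mset_Eword_inc[OF ij, symmetric])
          have E: "Emat i j \<in> sl n"
            using ij by (intro Emat_sl) (auto simp: set_positions)
          have "length (Eword n ?a) \<le> Suc d"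
            using 2 arg_cong[OF ms, of size] by simp
          then have "wd ([] @ Eword n ?a) \<in> pbw_span n Lam (Suc d)"
            unfolding pbw_span_def using 2(1) ij inc_GammaSet_iff[of j i n a]
            by (intro cspan.base) (auto simp: set_positions)
          from pbw_span_mset[OF short _ _ _ ms this, of d]
          show "wd (Emat i j # Eword n a) \<in> pbw_span n Lam (Suc d)"
            using 2 E set_Eword[of n a] by simp
        qed
        then show ?thesis using 2 by simp
      qed
    qed
    then show ?thesis using Cons by (simp add: pbw_span_def)
  qed
qed

text \<open>Words with letters outside sl(n) must be excluded: such a letter may act as zero without
  its word lying in the ideal.\<close>

definition tensors :: "nat \<Rightarrow> vect set" where
  "tensors n = cspan (wd ` words n)"

lemma fsupp_tensors: "f \<in> tensors n \<Longrightarrow> fsupp f"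
  unfolding tensors_def
proof (induction rule: cspan.induct)
  case zero
  then show ?case by (simp add: fsupp_def)
qed auto

theorem phi_eq_0_imp_cspan:
  assumes n: "1 \<le> n" and f: "f \<in> tensors n" and "phi n Lam f = (\<lambda>_. 0)"
  shows "f \<in> cspan (Mrels n Lam)"
proof -
  have "f \<in> cspan (Mrels n Lam \<union> (\<lambda>a. wd (Eword n a)) ` GammaSet n)"
    using f unfolding tensors_def
  proof induction
    case (base f)
    then obtain w where w: "w \<in> words n" "f = wd w" by auto
    then have "f \<in> pbw_span n Lam (length w)" by (simp add: word_in_pbw_span)
    moreover have "pbw_span n Lam (length w) \<subseteq> cspan (Mrels n Lam \<union> (\<lambda>a. wd (Eword n a)) ` GammaSet n)"
      unfolding pbw_span_def by (intro cspan_mono Un_mono image_mono) auto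
    ultimately show ?case by auto
  qed (auto intro: cspan.intros)
  from cspan_un_decomp[OF this] obtain h F c where h: "h \<in> cspan (Mrels n Lam)"
    and F: "finite F" "F \<subseteq> GammaSet n" "f = (\<lambda>t. h t + (\<Sum>b\<in>F. c b * wd (Eword n b) t))"
    by blast
  have phi: "phi n Lam f = (\<lambda>a. \<Sum>b\<in>F. c b * act n Lam (Eword n b) a)"
    unfolding F(3) using cspan_kernel[OF n h]
    by (simp add: phi_add fsupp_sum phi_sum phi_scale)
  then have 0: "(\<Sum>b\<in>F. c b * mon (case_prod b) a) = 0" for a
  proof -
    have "(\<Sum>b\<in>F. c b * mon (case_prod b) a) = (\<Sum>b\<in>F. c b * act n Lam (Eword n b) a)"
      using F(2) by (intro sum.cong refl) (auto simp: act_Eword)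
    also have "\<dots> = phi n Lam f a" by (simp only: phi)
    finally show ?thesis by (simp only: assms(3))
  qed
  have "c b = 0" if "b \<in> F" for b
  proof -
    have inj: "b' = b" if "case_prod b' = case_prod b" for b' :: "nat \<Rightarrow> nat \<Rightarrow> nat"
      using arg_cong[OF that, of curry] by simp
    have "(\<Sum>b'\<in>F. c b' * mon (case_prod b') (case_prod b)) = (\<Sum>b'\<in>F. if b' = b then c b' else 0)"
      by (intro sum.cong refl) (auto simp: mon_def dest: inj[OF sym] inj)
    also have "\<dots> = c b" using F(1) that by (simp add: sum.delta)
    finally show ?thesis using 0 by simp
  qed
  then have "f = h" by (simp add: F(3))
  with h show ?thesis by simp
qed

section \<open>Weights of ordered words\<close>

definition dec :: "(nat \<Rightarrow> nat \<Rightarrow> nat) \<Rightarrow> nat \<Rightarrow> nat \<Rightarrow> nat \<Rightarrow> nat \<Rightarrow> nat" where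
  "dec a p q = (\<lambda>i j. a i j - (if i = p \<and> j = q then 1 else 0))"

lemma inc_dec: "a p q \<noteq> 0 \<Longrightarrow> inc (dec a p q) p q = a"
  by (auto simp: inc_def dec_def fun_eq_iff)

lemma double_sum_delta:
  fixes c :: "'a::comm_monoid_add"
  assumes "p \<in> {1..n::nat}" "q \<in> {1..n::nat}"
  shows "(\<Sum>i=1..n. \<Sum>j=1..n. if i = p \<and> j = q then c else 0) = c"
proof -
  have "(\<Sum>i=1..n. \<Sum>j=1..n. if i = p \<and> j = q then c else 0) = (\<Sum>i=1..n. if i = p then c else 0)"
    by (intro sum.cong refl) (use assms in \<open>auto simp: sum.delta\<close>)
  with assms show ?thesis by (simp add: sum.delta)
qed

lemma double_prod_delta:
  fixes c :: "'a::comm_monoid_mult"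
  assumes "p \<in> {1..n::nat}" "q \<in> {1..n::nat}"
  shows "(\<Prod>i=1..n. \<Prod>j=1..n. if i = p \<and> j = q then c else 1) = c"
proof -
  have "(\<Prod>i=1..n. \<Prod>j=1..n. if i = p \<and> j = q then c else 1) = (\<Prod>i=1..n. if i = p then c else 1)"
    by (intro prod.cong refl) (use assms in \<open>auto simp: prod.delta\<close>)
  with assms show ?thesis by (simp add: prod.delta)
qed

lemma r_i_inc:
  assumes "1 \<le> q" "q < p" "p \<le> n"
  shows "r_i n (inc a p q) t = r_i n a t + (if q < t + 1 \<and> t + 1 < p then 1 else 0)"
proof -
  have "r_i n (inc a p q) t = r_i n a t
      + (\<Sum>i=1..n. \<Sum>j=1..n. if i = p \<and> j = q then (if q < t + 1 \<and> t + 1 < p then 1 else 0) else 0)"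
    unfolding r_i_def sum.distrib[symmetric]
    by (intro sum.cong refl) (auto simp: inc_def)
  also have "(\<Sum>i=1..n. \<Sum>j=1..n. if i = p \<and> j = q then (if q < t + 1 \<and> t + 1 < p then 1::nat else 0) else 0)
      = (if q < t + 1 \<and> t + 1 < p then 1 else 0)"
    by (rule double_sum_delta) (use assms in auto)
  finally show ?thesis .
qed

definition facts_prod :: "nat \<Rightarrow> (nat \<Rightarrow> nat \<Rightarrow> nat) \<Rightarrow> nat" where
  "facts_prod n a = (\<Prod>i=1..n. \<Prod>j=1..n. if j < i then fact (a i j) else 1)"

lemma facts_prod_inc:
  assumes "1 \<le> q" "q < p" "p \<le> n"
  shows "facts_prod n (inc a p q) = facts_prod n a * (a p q + 1)"
proof -
  have "facts_prod n (inc a p q) = facts_prod n a * (\<Prod>i=1..n. \<Prod>j=1..n. if i = p \<and> j = q then a p q + 1 else 1)"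
    unfolding facts_prod_def prod.distrib[symmetric]
    by (intro prod.cong refl) (use assms in \<open>auto simp: inc_def\<close>)
  also have "(\<Prod>i=1..n. \<Prod>j=1..n. if i = p \<and> j = q then a p q + 1 else 1) = a p q + 1"
    by (rule double_prod_delta) (use assms in auto)
  finally show ?thesis .
qed

lemma facts_prod_pos: "facts_prod n a > 0"
  unfolding facts_prod_def by (intro prod_pos) auto

section \<open>Row sums, column sums and flows across a cut\<close>

definition row :: "nat \<Rightarrow> (nat \<Rightarrow> nat \<Rightarrow> nat) \<Rightarrow> nat \<Rightarrow> nat" where
  "row n a p = (\<Sum>j=1..n. a p j)"

definition col :: "nat \<Rightarrow> (nat \<Rightarrow> nat \<Rightarrow> nat) \<Rightarrow> nat \<Rightarrow> nat" where
  "col n a p = (\<Sum>i=1..n. a i p)"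

lemma row_inc: assumes "1 \<le> q" "q \<le> n"
  shows "row n (inc a p q) t = row n a t + (if t = p then 1 else 0)"
  using assms by (auto simp: row_def inc_def sum.distrib sum.delta)

lemma col_inc: assumes "1 \<le> p" "p \<le> n"
  shows "col n (inc a p q) t = col n a t + (if t = q then 1 else 0)"
  using assms by (auto simp: col_def inc_def sum.distrib sum.delta)

text \<open>E^a has weight \<Sum> a_{i,j} (e_i - e_j), whose coefficient at e_p is row sum minus
  column sum; this is to be m (e_l - e_k). Both sides carry additions so that the equation stays in
  the natural numbers.\<close>

definition balanced :: "nat \<Rightarrow> nat \<Rightarrow> nat \<Rightarrow> nat \<Rightarrow> (nat \<Rightarrow> nat \<Rightarrow> nat) \<Rightarrow> bool" where
  "balanced n m k l a \<longleftrightarrow> a \<in> GammaSet n \<and>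
     (\<forall>p\<in>{1..n}. row n a p + (if p = k then m else 0) = col n a p + (if p = l then m else 0))"

text \<open>With a_{i,j} units on the edge from j to i, this is the amount crossing the cut between
  t and t+1.\<close>

definition flow :: "nat \<Rightarrow> (nat \<Rightarrow> nat \<Rightarrow> nat) \<Rightarrow> nat \<Rightarrow> nat" where
  "flow n a t = (\<Sum>i=1..n. \<Sum>j=1..n. if j \<le> t \<and> t < i then a i j else 0)"

text \<open>Add the balance equations over the vertices p \<le> t. An edge inside {1..t} counts in
  one row and one column and cancels; an edge crossing the cut counts only in a column, and since
  edges go upwards none comes back.\<close>

lemma flow_balanced:
  assumes a: "balanced n m k l a" and kl: "1 \<le> k" "k < l" "l \<le> n" and "t \<le> n"
  shows "flow n a t = (if k \<le> t \<and> t < l then m else 0)"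
proof -
  have G: "a i j = 0 \<or> j < i" for i j
    using a by (auto simp: balanced_def GammaSet_def)
  have *: "(\<Sum>p=1..n. if p \<le> t then g p else 0) = (\<Sum>p=1..t. g p)" for g :: "nat \<Rightarrow> nat"
  proof -
    have "{1..t} = {p \<in> {1..n}. p \<le> t}" using \<open>t \<le> n\<close> by auto
    then show ?thesis by (simp add: sum.inter_filter[symmetric])
  qed
  have R: "(\<Sum>p=1..t. row n a p) = (\<Sum>i=1..n. \<Sum>j=1..n. if i \<le> t then a i j else 0)"
    unfolding *[symmetric] row_def by (intro sum.cong refl) auto
  have "(\<Sum>p=1..t. col n a p) = (\<Sum>j=1..n. \<Sum>i=1..n. if j \<le> t then a i j else 0)"
    unfolding *[symmetric] col_def by (intro sum.cong refl) auto
  also have "\<dots> = (\<Sum>i=1..n. \<Sum>j=1..n. if j \<le> t then a i j else 0)"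
    by (rule sum.swap)
  also have "\<dots> = (\<Sum>i=1..n. \<Sum>j=1..n.
      (if j \<le> t \<and> t < i then a i j else 0) + (if i \<le> t then a i j else 0))"
  proof (intro sum.cong refl)
    fix i j
    show "(if j \<le> t then a i j else 0) = (if j \<le> t \<and> t < i then a i j else 0) + (if i \<le> t then a i j else 0)"
      using G[of i j] by auto
  qed
  also have "\<dots> = flow n a t + (\<Sum>p=1..t. row n a p)"
    by (simp only: R flow_def sum.distrib)
  finally have C: "(\<Sum>p=1..t. col n a p) = flow n a t + (\<Sum>p=1..t. row n a p)" .
  have "(\<Sum>p=1..t. row n a p + (if p = k then m else 0)) = (\<Sum>p=1..t. col n a p + (if p = l then m else 0))"
    using a \<open>t \<le> n\<close> by (intro sum.cong refl) (auto simp: balanced_def)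
  then have "(\<Sum>p=1..t. row n a p) + (if k \<le> t then m else 0) = (\<Sum>p=1..t. col n a p) + (if l \<le> t then m else 0)"
    using kl by (auto simp: sum.distrib sum.delta split: if_splits)
  with C kl show ?thesis by (auto split: if_splits)
qed

lemma entry_le_flow:
  assumes "j \<le> t" "t < i" "i \<in> {1..n}" "j \<in> {1..n}"
  shows "a i j \<le> flow n a t"
proof -
  have "(\<Sum>p=1..n. \<Sum>q=1..n. if p = i \<and> q = j then a i j else 0) \<le> flow n a t"
    unfolding flow_def by (intro sum_mono) (use assms in auto)
  then show ?thesis using double_sum_delta[OF assms(3,4), of "a i j"] by simp
qed

text \<open>An edge from j to i crosses the cuts j and i-1. Both must carry flow, hence lie between
  k and l-1.\<close>

lemma balanced_support:
  assumes "balanced n m k l a" "1 \<le> k" "k < l" "l \<le> n" "a i j \<noteq> 0"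
  shows "k \<le> j \<and> j < i \<and> i \<le> l"
proof -
  have G: "1 \<le> j" "j < i" "i \<le> n" using assms by (auto simp: balanced_def GammaSet_def)
  have "j \<le> i - 1" "i - 1 < i" using G by auto
  then have "a i j \<le> flow n a j" "a i j \<le> flow n a (i - 1)"
    using G by (auto intro!: entry_le_flow)
  then have "flow n a j \<noteq> 0" "flow n a (i - 1) \<noteq> 0"
    using assms(5) by linarith+
  then show ?thesis
    using flow_balanced[OF assms(1-4), of j] flow_balanced[OF assms(1-4), of "i - 1"] G
    by (auto split: if_splits)
qed

lemma balanced_entry_le:
  assumes "balanced n m k l a" "1 \<le> k" "k < l" "l \<le> n"
  shows "a i j \<le> m"
proof (cases "a i j = 0")
  case False
  with assms have G: "1 \<le> j" "j < i" "i \<le> n" by (auto simp: balanced_def GammaSet_def)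
  then show ?thesis
    using entry_le_flow[of j j i n a] flow_balanced[OF assms, of j] by (auto split: if_splits)
qed simp

text \<open>What crosses the cut after t either ends at t+1, counted by the row sum, or jumps over
  t+1, counted by r_t.\<close>

lemma flow_eq_r_i:
  assumes "a \<in> GammaSet n" "t < n"
  shows "flow n a t = r_i n a t + row n a (t + 1)"
proof -
  have G: "a i j = 0 \<or> j < i" for i j
    using assms by (auto simp: GammaSet_def)
  have "row n a (t + 1) = (\<Sum>i=1..n. if i = t + 1 then row n a (t + 1) else 0)"
    using assms by (simp add: sum.delta)
  also have "\<dots> = (\<Sum>i=1..n. \<Sum>j=1..n. if i = t + 1 then a i j else 0)"
    by (intro sum.cong refl) (auto simp: row_def)
  finally have row: "row n a (t + 1) = (\<Sum>i=1..n. \<Sum>j=1..n. if i = t + 1 then a i j else 0)" .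
  have "(if j \<le> t \<and> t < i then a i j else 0)
      = (if j < t + 1 \<and> t + 1 < i then a i j else 0) + (if i = t + 1 then a i j else 0)" for i j
    using G[of i j] by auto
  then show ?thesis
    unfolding row flow_def r_i_def sum.distrib[symmetric] by simp
qed

text \<open>This identifies m - r_t with the sum of row t+1, the link between the factorials of the
  coefficient and the sums produced by E_{i,i+1}.\<close>

lemma balanced_r_i:
  assumes "balanced n m k l a" "1 \<le> k" "k < l" "l \<le> n" "k \<le> t" "t < l"
  shows "r_i n a t + row n a (t + 1) = m"
  using flow_eq_r_i[of a n t] flow_balanced[OF assms(1-4), of t] assms by (simp add: balanced_def)

text \<open>Balance depends only on the differences of row and column sums, that is, on the weight.
  The hypothesis states equality of these differences without subtraction.\<close>

lemma balanced_inc_cong: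
  assumes "1 \<le> q" "q < p" "p \<le> n" "1 \<le> q'" "q' < p'" "p' \<le> n"
    and "\<And>t. row n a t + (if t = p then 1 else 0) + col n b t + (if t = q' then 1 else 0)
       = row n b t + (if t = p' then 1 else 0) + col n a t + (if t = q then 1 else 0)"
    and "a \<in> GammaSet n \<longleftrightarrow> b \<in> GammaSet n"
  shows "balanced n m k l (inc a p q) \<longleftrightarrow> balanced n m k l (inc b p' q')"
proof -
  have "row n (inc a p q) t + x = col n (inc a p q) t + y
    \<longleftrightarrow> row n (inc b p' q') t + x = col n (inc b p' q') t + y" for t x y
  proof -
    have aux: "ra + e1 + x = ca + e2 + y \<longleftrightarrow> rb + e3 + x = cb + e4 + y"
      if "ra + e1 + cb + e4 = rb + e3 + ca + e2" for ra e1 cb e4 rb e3 ca e2 :: nat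
      using that by linarith
    have *: "1 \<le> p" "q \<le> n" "1 \<le> p'" "q' \<le> n" using assms(1-6) by auto
    show ?thesis
      unfolding row_inc[OF assms(1) *(2)] row_inc[OF assms(4) *(4)]
        col_inc[OF *(1) assms(3)] col_inc[OF *(3) assms(6)]
      by (rule aux[OF assms(7)])
  qed
  then show ?thesis
    using assms by (simp add: balanced_def inc_GammaSet_iff)
qed

lemma finite_balanced:
  assumes "1 \<le> k" "k < l" "l \<le> n"
  shows "finite {a. balanced n m k l a}"
proof -
  let ?S = "{f. \<forall>x. (x \<in> {1..n} \<times> {1..n} \<longrightarrow> f x \<in> {..m}) \<and> (x \<notin> {1..n} \<times> {1..n} \<longrightarrow> f x = 0)}"
  have "finite (curry ` ?S)"
    by (intro finite_imageI finite_set_of_finite_funs) auto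
  moreover have "{a. balanced n m k l a} \<subseteq> curry ` ?S"
  proof
    fix a assume "a \<in> {a. balanced n m k l a}"
    then have a: "balanced n m k l a" by simp
    have "a i j = 0" if "i \<notin> {1..n} \<or> j \<notin> {1..n}" for i j
      using a that unfolding balanced_def GammaSet_def by fastforce
    then have "case_prod a \<in> ?S"
      using balanced_entry_le[OF a assms] by auto
    then show "a \<in> curry ` ?S" by (intro image_eqI[of _ _ "case_prod a"]) auto
  qed
  ultimately show ?thesis by (rule rev_finite_subset)
qed

section \<open>Commuting Cartan elements past ordered words\<close>

lemma cartan_sl: "H \<in> cartan n \<Longrightarrow> H \<in> sl n" and cartan_borel: "H \<in> cartan n \<Longrightarrow> H \<in> borel n"
  by (auto simp: cartan_def borel_def)

lemma bracket_cartan_Emat: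
  assumes H: "H \<in> cartan n" and ij: "i \<in> {1..n}" "j \<in> {1..n}"
  shows "mbracket n H (Emat i j) = msmult (H i i - H j j) (Emat i j)"
proof (intro ext)
  fix p q
  have H0: "H s t = 0" if "s \<noteq> t" for s t using H that by (simp add: cartan_def)
  have "(\<Sum>t=1..n. H p t * Emat i j t q) = (\<Sum>t=1..n. if t = i then H p i * (if q = j then 1 else 0) else 0)"
    by (intro sum.cong refl) (auto simp: Emat_def)
  moreover have "(\<Sum>t=1..n. Emat i j p t * H t q) = (\<Sum>t=1..n. if t = j then (if p = i then 1 else 0) * H j q else 0)"
    by (intro sum.cong refl) (auto simp: Emat_def)
  ultimately show "mbracket n H (Emat i j) p q = msmult (H i i - H j j) (Emat i j) p q"
    using ij H0 by (auto simp: mbracket_def msmult_def Emat_def sum.delta)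
qed

lemma wd_msmult:
  assumes "u \<in> words n" "w \<in> words n" "X \<in> sl n"
  shows "(\<lambda>t. wd (u @ [msmult c X] @ w) t - c * wd (u @ [X] @ w) t) \<in> cspan (Urels n)"
proof -
  \<comment> \<open>The linearity relations have no purely homogeneous instance. With the zero
    matrix, Z + 1 Z = Z puts the word u Z w itself into the ideal, and Z + c X = c X then gives
    homogeneity.\<close>
  define Z :: cmat where "Z = (\<lambda>_ _. 0)"
  have Z: "Z \<in> sl n" "madd Z (msmult 1 Z) = Z" "madd Z (msmult c X) = msmult c X"
    by (simp_all add: Z_def sl_def madd_def msmult_def)
  have "(\<lambda>t. wd (u @ [Z] @ w) t - wd (u @ [Z] @ w) t - 1 * wd (u @ [Z] @ w) t) \<in> Urels n"
    using Urels_lin[OF assms(1,2) Z(1,1), of 1] by (simp only: Z(2))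
  moreover have "(\<lambda>t. wd (u @ [msmult c X] @ w) t - wd (u @ [Z] @ w) t - c * wd (u @ [X] @ w) t) \<in> Urels n"
    using Urels_lin[OF assms(1,2) Z(1) assms(3), of c] by (simp only: Z(3))
  ultimately have "(\<lambda>t. (wd (u @ [msmult c X] @ w) t - wd (u @ [Z] @ w) t - c * wd (u @ [X] @ w) t)
      - (wd (u @ [Z] @ w) t - wd (u @ [Z] @ w) t - 1 * wd (u @ [Z] @ w) t)) \<in> cspan (Urels n)"
    by (intro cspan_diff cspan.base)
  then show ?thesis by simp
qed

text \<open>The prefix u is general because, once H has passed the first letter, that letter joins
  the prefix.\<close>

lemma cartan_commute_word:
  assumes H: "H \<in> cartan n" and "set L \<subseteq> set (positions n)" "u \<in> words n"
  shows "(\<lambda>t. wd (u @ H # map (\<lambda>p. Emat (fst p) (snd p)) L) t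
      - wd (u @ map (\<lambda>p. Emat (fst p) (snd p)) L @ [H]) t
      - (\<Sum>p\<leftarrow>L. H (fst p) (fst p) - H (snd p) (snd p)) * wd (u @ map (\<lambda>p. Emat (fst p) (snd p)) L) t)
    \<in> cspan (Urels n)"
  using assms(2,3)
proof (induction L arbitrary: u)
  case Nil
  then show ?case by (simp add: cspan.zero)
next
  case (Cons p L)
  let ?E = "\<lambda>p. Emat (fst p) (snd p)" and ?h = "\<lambda>p. H (fst p) (fst p) - H (snd p) (snd p)"
  have p: "1 \<le> snd p" "snd p < fst p" "fst p \<le> n" using Cons.prems by (auto simp: set_positions)
  have E: "?E q \<in> sl n" if "q \<in> set (positions n)" for q
    using that by (auto simp: set_positions intro!: Emat_sl)
  have w: "map ?E L \<in> words n" "u @ [?E p] \<in> words n" "?E p \<in> sl n"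
    using Cons.prems E by (auto simp: words_def)
  have "(\<lambda>t. wd (u @ [H, ?E p] @ map ?E L) t - wd (u @ [?E p, H] @ map ?E L) t
      - wd (u @ [mbracket n H (?E p)] @ map ?E L) t) \<in> cspan (Urels n)"
    by (intro cspan.base Urels_com cartan_sl H w Cons.prems)
  moreover have "mbracket n H (?E p) = msmult (?h p) (?E p)"
    using p by (intro bracket_cartan_Emat H) auto
  ultimately have 1: "(\<lambda>t. wd (u @ [H, ?E p] @ map ?E L) t - wd (u @ [?E p, H] @ map ?E L) t
      - wd (u @ [msmult (?h p) (?E p)] @ map ?E L) t) \<in> cspan (Urels n)"
    by simp
  have 2: "(\<lambda>t. wd (u @ [msmult (?h p) (?E p)] @ map ?E L) t - ?h p * wd (u @ [?E p] @ map ?E L) t) \<in> cspan (Urels n)"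
    by (intro wd_msmult Cons.prems w)
  have 3: "(\<lambda>t. wd ((u @ [?E p]) @ H # map ?E L) t - wd ((u @ [?E p]) @ map ?E L @ [H]) t
      - (\<Sum>p\<leftarrow>L. ?h p) * wd ((u @ [?E p]) @ map ?E L) t) \<in> cspan (Urels n)"
    by (rule Cons.IH) (use Cons.prems w in auto)
  \<comment> \<open>The bracket at the first letter, the scalar pulled out of that bracket, and the
    hypothesis with the first letter in the prefix; the intermediate words cancel.\<close>
  from cspan.add[OF cspan.add[OF 1 2] 3] show ?case
    by (simp add: algebra_simps)
qed

lemma cartan_commute_Eword:
  assumes H: "H \<in> cartan n"
  shows "(\<lambda>t. wd ([H] @ Eword n a) t - wd (Eword n a @ [H]) t
      - (\<Sum>p\<in>set (positions n). of_nat (a (fst p) (snd p)) * (H (fst p) (fst p) - H (snd p) (snd p))) * wd (Eword n a) t)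
    \<in> cspan (Urels n)"
proof -
  let ?h = "\<lambda>p. H (fst p) (fst p) - H (snd p) (snd p)"
  let ?L = "concat (map (\<lambda>p. replicate (a (fst p) (snd p)) p) (positions n))"
  have A: "map (\<lambda>p. Emat (fst p) (snd p)) ?L = Eword n a"
    by (simp add: Eword_positions map_concat comp_def)
  have "(\<Sum>p\<leftarrow>concat (map (\<lambda>p. replicate (a (fst p) (snd p)) p) L). ?h p)
      = (\<Sum>p\<leftarrow>L. of_nat (a (fst p) (snd p)) * ?h p)" for L
    by (induction L) (simp_all add: sum_list_replicate)
  then have B: "(\<Sum>p\<leftarrow>?L. ?h p) = (\<Sum>p\<in>set (positions n). of_nat (a (fst p) (snd p)) * ?h p)"
    by (simp only: sum_list_distinct_conv_sum_set[OF distinct_positions])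
  have C: "set ?L \<subseteq> set (positions n)" "[] \<in> words n"
    by (auto simp: words_def)
  show ?thesis
    using cartan_commute_word[OF H C] unfolding A B by simp
qed

lemma weight_eq_row_col:
  fixes h :: "nat \<Rightarrow> complex"
  assumes "a \<in> GammaSet n"
  shows "(\<Sum>p\<in>set (positions n). of_nat (a (fst p) (snd p)) * (h (fst p) - h (snd p)))
     = (\<Sum>t=1..n. h t * (of_nat (row n a t) - of_nat (col n a t)))"
proof -
  have "(\<Sum>p\<in>set (positions n). of_nat (a (fst p) (snd p)) * (h (fst p) - h (snd p)))
      = (\<Sum>p\<in>{1..n} \<times> {1..n}. of_nat (a (fst p) (snd p)) * (h (fst p) - h (snd p)))"
    by (rule sum.mono_neutral_left) (use assms in \<open>auto simp: set_positions GammaSet_def\<close>)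
  also have "\<dots> = (\<Sum>i=1..n. \<Sum>j=1..n. of_nat (a i j) * (h i - h j))"
    by (simp add: sum.cartesian_product split_def)
  also have "\<dots> = (\<Sum>i=1..n. \<Sum>j=1..n. of_nat (a i j) * h i) - (\<Sum>i=1..n. \<Sum>j=1..n. of_nat (a i j) * h j)"
    by (simp add: right_diff_distrib sum_subtractf)
  also have "(\<Sum>i=1..n. \<Sum>j=1..n. of_nat (a i j) * h j) = (\<Sum>j=1..n. \<Sum>i=1..n. of_nat (a i j) * h j)"
    by (rule sum.swap)
  finally show ?thesis
    by (simp add: row_def col_def right_diff_distrib sum_subtractf sum_distrib_left mult.commute)
qed

lemma coroot_cartan:
  assumes "p \<in> {1..n}" "q \<in> {1..n}" shows "coroot p q \<in> cartan n"
proof -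
  have "(\<Sum>i=1..n. coroot p q i i) = (\<Sum>i=1..n. if i = p then 1 else 0) - (\<Sum>i=1..n. if i = q then 1 else 0)"
    unfolding sum_subtractf[symmetric] by (intro sum.cong refl) (auto simp: coroot_def Emat_def)
  then have "(\<Sum>i=1..n. coroot p q i i) = 0" using assms by (simp add: sum.delta)
  with assms show ?thesis by (auto simp: cartan_def sl_def coroot_def Emat_def)
qed

text \<open>Let d be the defect of the balance equation. Traceless diagonal matrices, tested through
  the coroots, only show that d is constant; its total over 1..n is 0 because each letter lies in
  one row and one column, so the constant is 0.\<close>

lemma balanced_iff_weight:
  assumes a: "a \<in> GammaSet n" and kl: "1 \<le> k" "k < l" "l \<le> n"
  shows "balanced n m k l a \<longleftrightarrow> (\<forall>H\<in>cartan n.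
      (\<Sum>p\<in>set (positions n). of_nat (a (fst p) (snd p)) * (H (fst p) (fst p) - H (snd p) (snd p)))
      = of_nat m * (H l l - H k k))"
proof -
  define d where "d t = (of_nat (row n a t) + (if t = k then of_nat m else 0)
      - (of_nat (col n a t) + (if t = l then of_nat m else 0)) :: complex)" for t
  have dsum: "(\<Sum>t=1..n. h t * d t)
      = (\<Sum>p\<in>set (positions n). of_nat (a (fst p) (snd p)) * (h (fst p) - h (snd p)))
        - of_nat m * (h l - h k)" for h :: "nat \<Rightarrow> complex"
  proof -
    have "h t * d t = h t * (of_nat (row n a t) - of_nat (col n a t))
        + (if t = k then h k * of_nat m else 0) - (if t = l then h l * of_nat m else 0)" for t
      by (simp add: d_def algebra_simps)
    then have "(\<Sum>t=1..n. h t * d t) = (\<Sum>t=1..n. h t * (of_nat (row n a t) - of_nat (col n a t)))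
        + (\<Sum>t=1..n. if t = k then h k * of_nat m else 0) - (\<Sum>t=1..n. if t = l then h l * of_nat m else 0)"
      by (simp only: sum.distrib sum_subtractf)
    also have "\<dots> = (\<Sum>t=1..n. h t * (of_nat (row n a t) - of_nat (col n a t))) - of_nat m * (h l - h k)"
      using kl by (simp add: sum.delta algebra_simps)
    finally show ?thesis
      by (simp only: weight_eq_row_col[OF a])
  qed
  have d0: "(\<Sum>t=1..n. d t) = 0"
    using dsum[of "\<lambda>_. 1"] by simp
  have bal: "balanced n m k l a \<longleftrightarrow> (\<forall>t\<in>{1..n}. d t = 0)"
  proof -
    have "d t = 0 \<longleftrightarrow> row n a t + (if t = k then m else 0) = col n a t + (if t = l then m else 0)" for t
    proof -
      have "d t = of_nat (row n a t + (if t = k then m else 0)) - of_nat (col n a t + (if t = l then m else 0))"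
        by (simp add: d_def)
      then show ?thesis by (simp only: right_minus_eq of_nat_eq_iff)
    qed
    then show ?thesis using a by (simp add: balanced_def)
  qed
  show ?thesis
  proof
    assume "balanced n m k l a"
    then have 0: "(\<Sum>t=1..n. h t * d t) = 0" for h
      using bal by (intro sum.neutral) auto
    show "\<forall>H\<in>cartan n.
      (\<Sum>p\<in>set (positions n). of_nat (a (fst p) (snd p)) * (H (fst p) (fst p) - H (snd p) (snd p)))
      = of_nat m * (H l l - H k k)"
    proof
      fix H :: cmat
      show "(\<Sum>p\<in>set (positions n). of_nat (a (fst p) (snd p)) * (H (fst p) (fst p) - H (snd p) (snd p)))
          = of_nat m * (H l l - H k k)"
        using dsum[of "\<lambda>t. H t t"] 0[of "\<lambda>t. H t t"] by simp
    qed
  next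
    assume W: "\<forall>H\<in>cartan n.
      (\<Sum>p\<in>set (positions n). of_nat (a (fst p) (snd p)) * (H (fst p) (fst p) - H (snd p) (snd p)))
      = of_nat m * (H l l - H k k)"
    have eq: "d p = d q" if "p \<in> {1..n}" "q \<in> {1..n}" for p q
    proof -
      have "(\<Sum>t=1..n. coroot p q t t * d t) = 0"
        using W[rule_format, OF coroot_cartan[OF that]] dsum[of "\<lambda>t. coroot p q t t"] by simp
      also have "(\<Sum>t=1..n. coroot p q t t * d t)
          = (\<Sum>t=1..n. if t = p then d p else 0) - (\<Sum>t=1..n. if t = q then d q else 0)"
        unfolding sum_subtractf[symmetric] by (intro sum.cong refl) (auto simp: coroot_def Emat_def)
      finally show ?thesis using that by (simp add: sum.delta)
    qed
    have "d p = 0" if "p \<in> {1..n}" for p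
    proof -
      have "(\<Sum>t=1..n. d t) = (\<Sum>t=1..n. d p)" by (intro sum.cong refl eq that)
      then have "of_nat n * d p = 0" using d0 by simp
      then show ?thesis using kl by simp
    qed
    then show "balanced n m k l a" using bal by simp
  qed
qed

lemma cspan_Urels_Mrels: "cspan (Urels n) \<subseteq> cspan (Mrels n Lam)"
  by (intro cspan_mono) (auto simp: Mrels_def)

text \<open>The ideal of U(g) does not involve lambda, so any Verma module can serve as a test;
  lambda = 0 is taken, where E^a still acts as a monomial.\<close>

lemma scaled_Eword_in_ideal:
  assumes "1 \<le> n" "a \<in> GammaSet n" "(\<lambda>t. c * wd (Eword n a) t) \<in> cspan (Urels n)"
  shows "c = 0"
proof -
  have "(\<lambda>t. c * wd (Eword n a) t) \<in> cspan (Mrels n (\<lambda>_. 0))"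
    using assms(3) cspan_Urels_Mrels by blast
  then have "phi n (\<lambda>_. 0) (\<lambda>t. c * wd (Eword n a) t) = (\<lambda>_. 0)"
    using cspan_kernel[OF assms(1)] by blast
  then have "c * mon (case_prod a) (case_prod a) = 0"
    by (simp only: phi_scale[OF fsupp_wd] phi_wd act_Eword[OF assms(2)] fun_eq_iff)
  then show ?thesis by (simp add: mon_def)
qed

lemma GammaM_eq_balanced:
  assumes kl: "1 \<le> k" "k < l" "l \<le> n"
  shows "GammaM n m k l = {a. balanced n m k l a}"
proof -
  have "a \<in> GammaM n m k l \<longleftrightarrow> balanced n m k l a" if a: "a \<in> GammaSet n" for a
  proof -
    have "(\<lambda>t. wd ([H] @ Eword n a) t - wd (Eword n a @ [H]) t
           - of_nat m * (H l l - H k k) * wd (Eword n a) t) \<in> cspan (Urels n)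
      \<longleftrightarrow> (\<Sum>p\<in>set (positions n). of_nat (a (fst p) (snd p)) * (H (fst p) (fst p) - H (snd p) (snd p)))
      = of_nat m * (H l l - H k k)" (is "?f \<in> _ \<longleftrightarrow> ?s = ?c") if H: "H \<in> cartan n" for H
    proof
      note com = cartan_commute_Eword[OF H, of a]
      show "?f \<in> cspan (Urels n)" if "?s = ?c"
        using com unfolding that .
      assume "?f \<in> cspan (Urels n)"
      from cspan_diff[OF this com] have "(\<lambda>t. (?s - ?c) * wd (Eword n a) t) \<in> cspan (Urels n)"
        by (simp add: left_diff_distrib)
      from scaled_Eword_in_ideal[OF _ a this] show "?s = ?c" using kl by simp
    qed
    then show ?thesis
      using a balanced_iff_weight[OF a kl, of m] by (simp add: GammaM_def)
  qed
  moreover have "a \<in> GammaSet n" if "a \<in> GammaM n m k l" for a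
    using that unfolding GammaM_def mem_Collect_eq by (rule conjunct1)
  moreover have "a \<in> GammaSet n" if "balanced n m k l a" for a
    using that unfolding balanced_def by (rule conjunct1)
  ultimately show ?thesis by blast
qed

section \<open>The simple root vectors on the singular vector\<close>

text \<open>The numerator of \<open>coeff\<close> as a function of the vector r alone, so that
  changing a letter amounts to updating one coordinate.\<close>

definition wgt :: "nat \<Rightarrow> nat \<Rightarrow> nat \<Rightarrow> (nat \<Rightarrow> complex) \<Rightarrow> (nat \<Rightarrow> nat) \<Rightarrow> complex" where
  "wgt k l m u r = (\<Prod>i=k..l-1. ffall (u i) (r i) * of_nat (fact (m - r i)))"

lemma coeff_wgt: "coeff n Lam m k l a = wgt k l m (u_i n Lam k) (r_i n a) / of_nat (facts_prod n a)"
  by (simp add: coeff_def wgt_def facts_prod_def)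

text \<open>When r_j grows by one, the falling factorial gains the factor u_j - r_j and the
  factorial loses m - r_j. This recursion is all that is used of the two factors.\<close>

lemma wgt_step:
  assumes "k \<le> j" "j < l" "r j < m"
  shows "of_nat (m - r j) * wgt k l m u (r(j := r j + 1)) = (u j - of_nat (r j)) * wgt k l m u r"
proof -
  let ?g = "\<lambda>r i. ffall (u i) (r i) * of_nat (fact (m - r i))"
  have j: "j \<in> {k..l-1}" using assms by auto
  have "(\<Prod>i\<in>{k..l-1} - {j}. ?g (r(j := r j + 1)) i) = (\<Prod>i\<in>{k..l-1} - {j}. ?g r i)"
    by (intro prod.cong refl) auto
  moreover obtain s where s: "m - r j = Suc s" "m - Suc (r j) = s"
    using assms(3) by (metis Suc_diff_Suc)
  have "of_nat (m - r j) * ?g (r(j := r j + 1)) j = (u j - of_nat (r j)) * ?g r j"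
    by (simp add: ffall_def s algebra_simps)
  ultimately show ?thesis
    unfolding wgt_def prod.remove[OF finite_atLeastAtMost j] by (simp add: mult_ac)
qed

lemma app_mul_der:
  assumes "(p, q) \<noteq> (p', q')"
  shows "app (mul_var (p, q) * der_var (p', q')) (\<lambda>c. V (curry c)) (case_prod b)
    = (if b p q = 0 then 0 else of_nat (b p' q' + 1) * V (inc (dec b p q) p' q'))"
proof -
  have "curry ((case_prod b)((p, q) := b p q - 1, (p', q') := b p' q' + 1)) = inc (dec b p q) p' q'"
    using assms by (auto simp: fun_eq_iff inc_def dec_def)
  then show ?thesis
    using assms by (auto simp: app_ops mul_var.rep_eq der_var.rep_eq)
qed

lemma app_der: "app (der_var (p, q)) (\<lambda>c. V (curry c)) (case_prod b) = of_nat (b p q + 1) * V (inc b p q)"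
proof -
  have "curry ((case_prod b)((p, q) := b p q + 1)) = inc b p q"
    by (auto simp: fun_eq_iff inc_def)
  then show ?thesis by (simp add: der_var.rep_eq)
qed

lemma app_euler: "app (mul_var p * der_var p) f b = of_nat (b p) * f b"
  by (simp add: app_ops mul_var.rep_eq der_var.rep_eq of_nat_diff)

lemma gen_simple:
  assumes "1 \<le> i" "i < n"
  shows "app (gen n Lam i (i + 1)) (\<lambda>c. V (curry c)) (case_prod b)
    = (\<Sum>c=1..<i. if b i c = 0 then 0 else of_nat (b (i + 1) c + 1) * V (inc (dec b i c) (i + 1) c))
    - (\<Sum>q\<in>{i+1<..n}. if b q (i + 1) = 0 then 0 else of_nat (b q i + 1) * V (inc (dec b q (i + 1)) q i))
    + (Lam i - (\<Sum>q\<in>{i<..n}. of_nat (b q i)) + (\<Sum>q\<in>{i+1<..n}. of_nat (b q (i + 1))))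
      * (of_nat (b (i + 1) i + 1) * V (inc b (i + 1) i))"
proof -
  have mu: "mu_of n Lam i - mu_of n Lam (i + 1) = Lam i"
    using assms by (simp add: mu_of_def sum.atLeast_Suc_lessThan)
  have n: "n - 1 < n" "n - (n - 1) \<le> i" "n - (n - 1) = 1" using assms by auto
  have 1: "app (\<Sum>c=1..<i. mul_var (i, c) * der_var (i + 1, c)) (\<lambda>c. V (curry c)) (case_prod b)
    = (\<Sum>c=1..<i. if b i c = 0 then 0 else of_nat (b (i + 1) c + 1) * V (inc (dec b i c) (i + 1) c))"
    unfolding app_sum by (intro sum.cong refl app_mul_der) simp
  have 2: "app (\<Sum>q\<in>{i+1<..n}. mul_var (q, i + 1) * der_var (q, i)) (\<lambda>c. V (curry c)) (case_prod b)
    = (\<Sum>q\<in>{i+1<..n}. if b q (i + 1) = 0 then 0 else of_nat (b q i + 1) * V (inc (dec b q (i + 1)) q i))"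
    unfolding app_sum by (intro sum.cong refl app_mul_der) simp
  have 3: "app ((sc (mu_of n Lam i) - sc (mu_of n Lam (i + 1)) - (\<Sum>k\<in>{i<..n}. mul_var (k, i) * der_var (k, i))
        + (\<Sum>k\<in>{i+1<..n}. mul_var (k, i + 1) * der_var (k, i + 1))) * der_var (i + 1, i))
        (\<lambda>c. V (curry c)) (case_prod b)
      = (Lam i - (\<Sum>q\<in>{i<..n}. of_nat (b q i)) + (\<Sum>q\<in>{i+1<..n}. of_nat (b q (i + 1))))
      * (of_nat (b (i + 1) i + 1) * V (inc b (i + 1) i))"
    unfolding mu[symmetric]
    by (simp only: times_lop.rep_eq[of _ "der_var (i + 1, i)"] plus_lop.rep_eq minus_lop.rep_eq app_sum app_sc
        app_euler app_der case_prod_conv left_diff_distrib distrib_right sum_distrib_right)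
  show ?thesis
    unfolding glV_super[OF n(1,2) assms(2)] n(3) by (simp only: plus_lop.rep_eq minus_lop.rep_eq 1 2 3)
qed

definition vcoeff :: "nat \<Rightarrow> (nat \<Rightarrow> complex) \<Rightarrow> nat \<Rightarrow> nat \<Rightarrow> nat \<Rightarrow> (nat \<Rightarrow> nat \<Rightarrow> nat) \<Rightarrow> complex" where
  "vcoeff n Lam m k l a = (if balanced n m k l a then coeff n Lam m k l a else 0)"

text \<open>The factor produced by the derivative cancels the new factor of the factorial at (p',
  q'), while the lost letter at (p, q) leaves its exponent in the numerator. Summing these exponents
  later yields row and column sums.\<close>

lemma facts_prod_shift:
  assumes "1 \<le> q" "q < p" "p \<le> n" "1 \<le> q'" "q' < p'" "p' \<le> n" "(p, q) \<noteq> (p', q')" "b p q \<noteq> 0"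
  shows "of_nat (b p' q' + 1) / of_nat (facts_prod n (inc (dec b p q) p' q'))
    = (of_nat (b p q) / of_nat (facts_prod n b) :: complex)"
proof -
  define \<beta> where "\<beta> = dec b p q"
  have b: "b = inc \<beta> p q" using assms(8) by (simp add: \<beta>_def inc_dec)
  have "b p q = \<beta> p q + 1" "b p' q' = \<beta> p' q'"
    using assms(7) by (auto simp: b inc_def)
  then have "facts_prod n b = facts_prod n \<beta> * b p q"
    "facts_prod n (inc \<beta> p' q') = facts_prod n \<beta> * (b p' q' + 1)"
    using facts_prod_inc[OF assms(1-3), of \<beta>] facts_prod_inc[OF assms(4-6), of \<beta>] b by simp_all
  then have "of_nat (facts_prod n b) = (of_nat (facts_prod n \<beta>) * of_nat (b p q) :: complex)"
    "of_nat (facts_prod n (inc \<beta> p' q')) = (of_nat (facts_prod n \<beta>) * of_nat (b p' q' + 1) :: complex)"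
    by (simp_all only: of_nat_mult)
  moreover have "of_nat (facts_prod n \<beta>) \<noteq> (0 :: complex)"
    using facts_prod_pos[of n \<beta>] by simp
  moreover have "of_nat (b p' q' + 1) \<noteq> (0 :: complex)"
    by (metis Suc_eq_plus1 of_nat_neq_0)
  ultimately show ?thesis
    unfolding \<beta>_def[symmetric] using assms(8) by (simp add: divide_simps)
qed

lemma GammaSet_zero: "a \<in> GammaSet n \<Longrightarrow> \<not> (1 \<le> j \<and> j < i \<and> i \<le> n) \<Longrightarrow> a i j = 0"
  unfolding GammaSet_def by blast

lemma row_balanced_sum:
  assumes "b \<in> GammaSet n" "i \<le> n" shows "row n b i = (\<Sum>c=1..<i. b i c)"
  unfolding row_def by (rule sum.mono_neutral_right) (use assms in \<open>auto intro: GammaSet_zero[OF assms(1)]\<close>)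

lemma col_balanced_sum:
  assumes "b \<in> GammaSet n" "1 \<le> i" shows "col n b i = (\<Sum>q\<in>{i<..n}. b q i)"
  unfolding col_def by (rule sum.mono_neutral_right) (use assms in \<open>auto intro: GammaSet_zero[OF assms(1)]\<close>)

text \<open>\<open>lam\<close> says rho(H_i) = 1, and \<open>um\<close> is the hypothesis on m after
  telescoping H_k + ... + H_{l-1}; both are discharged in the last theorem.\<close>

context
  fixes n k l m :: nat and Lam :: "nat \<Rightarrow> complex"
  assumes kl: "1 \<le> k" "k < l" "l \<le> n"
    and um: "u_i n Lam k (l - 1) = of_nat m"
    and lam: "\<And>i. 1 \<le> i \<Longrightarrow> i < n \<Longrightarrow> lam_i n Lam i = Lam i + 1"
begin

lemma u_first: "u_i n Lam k k = Lam k + 1"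
  using kl by (simp add: u_i_def lam)

lemma u_next: "k < i \<Longrightarrow> i < n \<Longrightarrow> u_i n Lam k i = u_i n Lam k (i - 1) + Lam i + 1"
proof -
  assume i: "k < i" "i < n"
  then have "{k..i} = insert i {k..i - 1}" by auto
  with i kl show ?thesis by (simp add: u_i_def lam)
qed

lemma vcoeff_support: "vcoeff n Lam m k l (inc x p q) \<noteq> 0 \<Longrightarrow> k \<le> q \<and> p \<le> l"
  using balanced_support[OF _ kl, of m "inc x p q" p q]
  by (auto simp: vcoeff_def inc_def split: if_splits)

text \<open>Replacing E_{i,c} by E_{i+1,c}, or E_{q,i+1} by E_{q,i} as in the next lemma, changes
  the weight by e_{i+1} - e_i, just as adding E_{i+1,i} does. So all terms of E_{i,i+1} at one
  exponent are balanced or none is.\<close>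

lemma balanced_row_shift:
  assumes i: "1 \<le> c" "c < i" "i < n" and nz: "b i c \<noteq> 0"
  shows "balanced n m k l (inc (dec b i c) (i + 1) c) \<longleftrightarrow> balanced n m k l (inc b (i + 1) i)"
proof -
  define \<beta> where "\<beta> = dec b i c"
  have b: "b = inc \<beta> i c" using nz by (simp add: \<beta>_def inc_dec)
  have "row n b t = row n \<beta> t + (if t = i then 1 else 0)" "col n b t = col n \<beta> t + (if t = c then 1 else 0)" for t
    unfolding b using i by (subst row_inc col_inc; simp)+
  then show ?thesis
    unfolding \<beta>_def[symmetric] using i
    by (intro balanced_inc_cong) (auto simp: b inc_GammaSet_iff)
qed

lemma balanced_col_shift:
  assumes i: "1 \<le> i" "i + 1 < q" "q \<le> n" and nz: "b q (i + 1) \<noteq> 0"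
  shows "balanced n m k l (inc (dec b q (i + 1)) q i) \<longleftrightarrow> balanced n m k l (inc b (i + 1) i)"
proof -
  define \<beta> where "\<beta> = dec b q (i + 1)"
  have b: "b = inc \<beta> q (i + 1)" using nz by (simp add: \<beta>_def inc_dec)
  have "row n b t = row n \<beta> t + (if t = q then 1 else 0)" "col n b t = col n \<beta> t + (if t = i + 1 then 1 else 0)" for t
    unfolding b using i by (subst row_inc col_inc; simp)+
  then show ?thesis
    unfolding \<beta>_def[symmetric] using i
    by (intro balanced_inc_cong) (auto simp: b inc_GammaSet_iff)
qed

text \<open>The common form of the two shifts. The new letter jumps over exactly one vertex more
  than the old one, namely s+1, so only r_s changes: s = i-1 for the row shift and s = i for the
  column shift.\<close>

lemma shift_term:
  assumes p: "1 \<le> q" "q < p" "p \<le> n" "1 \<le> q'" "q' < p'" "p' \<le> n" "(p, q) \<noteq> (p', q')"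
    and nz: "b p q \<noteq> 0" and bal: "balanced n m k l (inc (dec b p q) p' q')"
    and r: "\<And>t. (if q' < t + 1 \<and> t + 1 < p' then 1 else 0)
      = (if q < t + 1 \<and> t + 1 < p then 1 else 0) + (if t = s then 1 else 0 :: nat)"
  shows "of_nat (b p' q' + 1) * vcoeff n Lam m k l (inc (dec b p q) p' q')
    = of_nat (b p q) * (wgt k l m (u_i n Lam k) ((r_i n b)(s := r_i n b s + 1)) / of_nat (facts_prod n b))"
proof -
  let ?a = "inc (dec b p q) p' q'"
  have "r_i n b t = r_i n (inc (dec b p q) p q) t" for t
    by (simp only: inc_dec[of b p q, OF nz])
  then have rb: "r_i n b t = r_i n (dec b p q) t + (if q < t + 1 \<and> t + 1 < p then 1 else 0)" for t
    by (simp only: r_i_inc[OF p(1-3)])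
  have "r_i n ?a = (r_i n b)(s := r_i n b s + 1)"
  proof
    fix t
    have "r_i n ?a t = r_i n b t + (if t = s then 1 else 0)"
      unfolding r_i_inc[OF p(4-6)] rb r by (simp only: add.assoc)
    then show "r_i n ?a t = ((r_i n b)(s := r_i n b s + 1)) t" by simp
  qed
  then have "of_nat (b p' q' + 1) * vcoeff n Lam m k l ?a
      = wgt k l m (u_i n Lam k) ((r_i n b)(s := r_i n b s + 1))
        * (of_nat (b p' q' + 1) / of_nat (facts_prod n ?a))"
    using bal by (simp only: vcoeff_def coeff_wgt if_True times_divide_eq_right) (simp only: mult.commute)
  then show ?thesis
    unfolding facts_prod_shift[of q p n q' p' b, OF p nz] by simp
qed

lemma row_shift_term:
  assumes i: "1 \<le> c" "c < i" "i < n" and nz: "b i c \<noteq> 0" and bal: "balanced n m k l (inc b (i + 1) i)"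
  shows "of_nat (b (i + 1) c + 1) * vcoeff n Lam m k l (inc (dec b i c) (i + 1) c)
    = of_nat (b i c) * (wgt k l m (u_i n Lam k) ((r_i n b)(i - 1 := r_i n b (i - 1) + 1)) / of_nat (facts_prod n b))"
  by (rule shift_term) (use balanced_row_shift[of c i b, OF i nz] bal i nz in auto)

lemma col_shift_term:
  assumes i: "1 \<le> i" "i + 1 < q" "q \<le> n" and nz: "b q (i + 1) \<noteq> 0" and bal: "balanced n m k l (inc b (i + 1) i)"
  shows "of_nat (b q i + 1) * vcoeff n Lam m k l (inc (dec b q (i + 1)) q i)
    = of_nat (b q (i + 1)) * (wgt k l m (u_i n Lam k) ((r_i n b)(i := r_i n b i + 1)) / of_nat (facts_prod n b))"
  by (rule shift_term) (use balanced_col_shift[of i q b, OF i nz] bal i nz in auto)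

text \<open>E_{i+1,i} joins neighbouring vertices and jumps over none, so r stays the same.\<close>

lemma simple_term:
  assumes i: "1 \<le> i" "i < n" and bal: "balanced n m k l (inc b (i + 1) i)"
  shows "of_nat (b (i + 1) i + 1) * vcoeff n Lam m k l (inc b (i + 1) i)
    = wgt k l m (u_i n Lam k) (r_i n b) / of_nat (facts_prod n b)"
proof -
  have "r_i n (inc b (i + 1) i) = r_i n b"
    using i by (intro ext) (simp add: r_i_inc)
  moreover have "facts_prod n (inc b (i + 1) i) = facts_prod n b * (b (i + 1) i + 1)"
    by (rule facts_prod_inc) (use i in auto)
  then have "of_nat (facts_prod n (inc b (i + 1) i)) = (of_nat (facts_prod n b) * of_nat (b (i + 1) i + 1) :: complex)"
    by (simp only: of_nat_mult)
  moreover have "of_nat (b (i + 1) i + 1) \<noteq> (0 :: complex)"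
    by (metis Suc_eq_plus1 of_nat_neq_0)
  ultimately show ?thesis using bal by (simp add: vcoeff_def coeff_wgt)
qed

text \<open>For k < i < l-1, after removing the common factor, the three groups of terms give
  (u_{i-1} - r_{i-1}) - (u_i - r_i) + Lam_i - col_i + col_{i+1}. With col_i = m - r_{i-1} - 1 and
  col_{i+1} = m - r_i this is u_{i-1} - u_i + Lam_i + 1 = 0. The ends i = k and i = l-1 are treated
  separately.\<close>

lemma gen_simple_vcoeff:
  assumes i: "1 \<le> i" "i < n"
  shows "app (gen n Lam i (i + 1)) (\<lambda>c. vcoeff n Lam m k l (curry c)) (case_prod b) = 0"
proof -
  let ?V = "vcoeff n Lam m k l"
  consider (out) "\<not> (k \<le> i \<and> i < l)" | (unbal) "\<not> balanced n m k l (inc b (i + 1) i)"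
    | (bal) "k \<le> i" "i < l" "balanced n m k l (inc b (i + 1) i)" by blast
  then show ?thesis
  proof cases
    \<comment> \<open>Every term contains a letter crossing the cut between i and i+1, where a
      balanced exponent carries no flow.\<close>
    case out
    have "?V (inc x (i + 1) c) = 0" if "c \<le> i" for x c
      by (rule ccontr) (use vcoeff_support[of x "i + 1" c] that out in auto)
    moreover have "?V (inc x q i) = 0" if "i + 1 \<le> q" for x q
      by (rule ccontr) (use vcoeff_support[of x q i] that out in auto)
    ultimately show ?thesis
      unfolding gen_simple[OF i] by (simp add: sum.neutral)
  next
    case unbal
    have "?V (inc (dec b i c) (i + 1) c) = 0" if "1 \<le> c" "c < i" "b i c \<noteq> 0" for c
      using balanced_row_shift[of c i b] that i unbal by (simp add: vcoeff_def)
    moreover have "?V (inc (dec b q (i + 1)) q i) = 0" if "i + 1 < q" "q \<le> n" "b q (i + 1) \<noteq> 0" for q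
      using balanced_col_shift[of i q b] that i unbal by (simp add: vcoeff_def)
    moreover have "?V (inc b (i + 1) i) = 0" using unbal by (simp add: vcoeff_def)
    ultimately show ?thesis
      unfolding gen_simple[OF i] by (simp add: sum.neutral)
  next
    case bal
    let ?W = "wgt k l m (u_i n Lam k)" and ?r = "r_i n b" and ?a = "inc b (i + 1) i"
    let ?P = "of_nat (facts_prod n b) :: complex"
    let ?W1 = "?W (?r(i - 1 := ?r (i - 1) + 1))" and ?W2 = "?W (?r(i := ?r i + 1))"
    have G: "b \<in> GammaSet n"
      using bal(3) inc_GammaSet_iff[of i "i + 1" n b] i by (simp add: balanced_def)
    have T1: "(\<Sum>c=1..<i. if b i c = 0 then 0 else of_nat (b (i + 1) c + 1) * ?V (inc (dec b i c) (i + 1) c))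
        = of_nat (row n b i) * (?W1 / ?P)"
    proof -
      have "(\<Sum>c=1..<i. if b i c = 0 then 0 else of_nat (b (i + 1) c + 1) * ?V (inc (dec b i c) (i + 1) c))
        = (\<Sum>c=1..<i. of_nat (b i c) * (?W1 / ?P))"
      proof (intro sum.cong refl)
        fix c assume "c \<in> {1..<i}"
        then show "(if b i c = 0 then 0 else of_nat (b (i + 1) c + 1) * ?V (inc (dec b i c) (i + 1) c))
            = of_nat (b i c) * (?W1 / ?P)"
          using row_shift_term[of c i b] i bal(3) by (cases "b i c = 0") auto
      qed
      moreover have "row n b i = (\<Sum>c=1..<i. b i c)" using row_balanced_sum[OF G, of i] i by simp
      ultimately show ?thesis by (simp only: of_nat_sum sum_distrib_right)
    qed
    have T2: "(\<Sum>q\<in>{i+1<..n}. if b q (i + 1) = 0 then 0 else of_nat (b q i + 1) * ?V (inc (dec b q (i + 1)) q i))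
        = of_nat (col n b (i + 1)) * (?W2 / ?P)"
    proof -
      have "(\<Sum>q\<in>{i+1<..n}. if b q (i + 1) = 0 then 0 else of_nat (b q i + 1) * ?V (inc (dec b q (i + 1)) q i))
        = (\<Sum>q\<in>{i+1<..n}. of_nat (b q (i + 1)) * (?W2 / ?P))"
      proof (intro sum.cong refl)
        fix q assume "q \<in> {i+1<..n}"
        then show "(if b q (i + 1) = 0 then 0 else of_nat (b q i + 1) * ?V (inc (dec b q (i + 1)) q i))
            = of_nat (b q (i + 1)) * (?W2 / ?P)"
          using col_shift_term[of i q b] i bal(3) by (cases "b q (i + 1) = 0") auto
      qed
      moreover have "col n b (i + 1) = (\<Sum>q\<in>{i+1<..n}. b q (i + 1))" using col_balanced_sum[OF G, of "i + 1"] by simp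
      ultimately show ?thesis by (simp only: of_nat_sum sum_distrib_right)
    qed
    have C: "(\<Sum>q\<in>{i<..n}. of_nat (b q i)) = (of_nat (col n b i) :: complex)"
      "(\<Sum>q\<in>{i+1<..n}. of_nat (b q (i + 1))) = (of_nat (col n b (i + 1)) :: complex)"
      using col_balanced_sum[OF G, of i] col_balanced_sum[OF G, of "i + 1"] i by simp_all
    have rows: "row n ?a t = row n b t + (if t = i + 1 then 1 else 0)"
        "col n ?a t = col n b t + (if t = i then 1 else 0)" for t
      using i by (simp_all add: row_inc col_inc)
    have at: "row n ?a p + (if p = k then m else 0) = col n ?a p + (if p = l then m else 0)"
      if "p \<in> {1..n}" for p
      using bal(3) that by (simp add: balanced_def)
    have at_i: "row n b i + (if i = k then m else 0) = col n b i + 1"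
      using at[of i, unfolded rows] bal(1,2) i by simp
    have at_Si: "row n b (i + 1) + 1 = col n b (i + 1) + (if i + 1 = l then m else 0)"
      using at[of "i + 1", unfolded rows] bal(1,2) i by simp
    have r_a: "r_i n ?a t = ?r t" for t
      using i by (simp add: r_i_inc)
    \<comment> \<open>Balance holds for b with one more E_{i+1,i}, so row i+1 of b itself is one
      short; this is the source of the + 1.\<close>
    have r_at_i: "?r i + row n b (i + 1) + 1 = m"
      using balanced_r_i[OF bal(3) kl bal(1,2)] unfolding r_a rows by simp
    have "of_nat (m - ?r i) * ?W2 = (u_i n Lam k i - of_nat (?r i)) * ?W ?r"
      using bal r_at_i by (intro wgt_step) auto
    moreover have "m - ?r i = row n b (i + 1) + 1" using r_at_i by simp
    ultimately have W2: "(of_nat (row n b (i + 1)) + 1) * ?W2 = (u_i n Lam k i - of_nat (?r i)) * ?W ?r"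
      by (simp add: add.commute)
    have r_at_pred: "?r (i - 1) + row n b i = m" if "i \<noteq> k"
      using balanced_r_i[OF bal(3) kl, of "i - 1"] bal i that unfolding r_a rows by simp
    have row_i: "of_nat (row n b i) * ?W1 = (if i = k then 0 else (u_i n Lam k (i - 1) - of_nat (?r (i - 1))) * ?W ?r)"
    proof (cases "i = k")
      case True
      \<comment> \<open>No edge of a balanced exponent ends at k, so the first sum is empty for i =
        k.\<close>
      have "row n ?a k = 0"
        unfolding row_def using balanced_support[OF bal(3) kl, of k] by (intro sum.neutral) force
      then show ?thesis using True unfolding rows by simp
    next
      case False
      then have r1: "?r (i - 1) + row n b i = m" by (rule r_at_pred)
      have "of_nat (m - ?r (i - 1)) * ?W1 = (u_i n Lam k (i - 1) - of_nat (?r (i - 1))) * ?W ?r"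
        using bal r1 at_i False by (intro wgt_step) auto
      moreover have "m - ?r (i - 1) = row n b i" using r1 by simp
      ultimately show ?thesis using False by simp
    qed
    have "of_nat (row n b i) * ?W1 - of_nat (col n b (i + 1)) * ?W2
        + (Lam i - of_nat (col n b i) + of_nat (col n b (i + 1))) * ?W ?r = 0"
    proof -
      have col_i: "(of_nat (col n b i) :: complex)
          = (if i = k then of_nat m - 1 else of_nat m - of_nat (?r (i - 1)) - 1)"
      proof (cases "i = k")
        case True
        have "row n ?a k = 0"
          unfolding row_def using balanced_support[OF bal(3) kl, of k] by (intro sum.neutral) force
        then have "m = col n b i + 1" using True at_i unfolding rows by simp
        then show ?thesis using True by (simp only: of_nat_add if_True) simp
      next
        case False
        then have "m = ?r (i - 1) + (col n b i + 1)" using at_i r_at_pred by simp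
        then show ?thesis using False by (simp only: of_nat_add if_False) simp
      qed
      show ?thesis
      proof (cases "i + 1 = l")
        case True
        \<comment> \<open>Nothing leaves l and nothing jumps over it, so the second sum vanishes.
          The value u_{l-1} = m takes its place in the cancellation.\<close>
        then have z: "col n b (i + 1) = 0" "?r i = 0" using at_Si r_at_i by auto
        have ul: "u_i n Lam k i = of_nat m" using um True by auto
        show ?thesis
        proof (cases "i = k")
          case True
          then show ?thesis using ul u_first unfolding row_i col_i z by (simp add: algebra_simps)
        next
          case False
          then have "of_nat m = u_i n Lam k (i - 1) + Lam i + 1" using u_next[of i] ul bal i by simp
          then show ?thesis using False unfolding row_i col_i z by (simp add: algebra_simps)
        qed
      next
        case False
        then have c: "of_nat (col n b (i + 1)) = (of_nat (row n b (i + 1)) + 1 :: complex)"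
          using arg_cong[OF at_Si, of "of_nat :: nat \<Rightarrow> complex"] by (simp add: add.commute)
        have m: "of_nat m = of_nat (?r i) + (of_nat (row n b (i + 1)) + 1 :: complex)"
          using arg_cong[OF r_at_i, of "of_nat :: nat \<Rightarrow> complex"] by (simp add: add_ac)
        show ?thesis
        proof (cases "i = k")
          case True
          then show ?thesis using u_first unfolding row_i col_i c W2 m by (simp add: algebra_simps)
        next
          case False
          then have "u_i n Lam k i = u_i n Lam k (i - 1) + Lam i + 1" using u_next[of i] bal i by simp
          then show ?thesis using False unfolding row_i col_i c W2 m by (simp add: algebra_simps)
        qed
      qed
    qed
    moreover have "?P \<noteq> 0" using facts_prod_pos[of n b] by simp
    ultimately show ?thesis
      unfolding gen_simple[OF i] T1 T2 C simple_term[OF i bal(3)]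
      by (simp add: divide_simps)
  qed
qed

end

section \<open>The action of the Borel subalgebra on the singular vector\<close>

lemma gen_diag:
  assumes "1 \<le> i" "i \<le> n"
  shows "app (gen n Lam i i) (\<lambda>c. V (curry c)) (case_prod b)
    = (mu_of n Lam i - (\<Sum>q\<in>{i<..n}. of_nat (b q i)) + (\<Sum>c=1..<i. of_nat (b i c))) * V b"
proof -
  have n: "n - 1 < n" "n - (n - 1) \<le> i" "n - (n - 1) = 1" using assms by auto
  show ?thesis
    unfolding glV_diag[OF n(1,2) assms(2)] n(3)
    by (simp only: plus_lop.rep_eq minus_lop.rep_eq app_sum app_sc app_euler case_prod_conv curry_case_prod
        left_diff_distrib distrib_right sum_distrib_right)
qed

text \<open>The simple root vectors generate the nilradical: induction on the height of the root
  through E_{i,j+1} = [E_{i,j}, E_{j,j+1}].\<close>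

lemma gen_upper_zero:
  assumes n: "1 \<le> n" and simple: "\<And>i. 1 \<le> i \<Longrightarrow> i < n \<Longrightarrow> app (gen n Lam i (i + 1)) f = (\<lambda>_. 0)"
    and i: "1 \<le> i"
  shows "i + d + 1 \<le> n \<Longrightarrow> app (gen n Lam i (i + d + 1)) f = (\<lambda>_. 0)"
proof (induction d)
  case 0
  then show ?case using simple[of i] i by simp
next
  case (Suc d)
  let ?G = "gen n Lam" and ?j = "i + d + 1"
  have "comm (?G i ?j) (?G ?j (?j + 1)) = ?G i (?j + 1)"
    using gl_rel_gen[OF n, of Lam] Suc.prems i unfolding gl_rel_def by simp
  then have "app (?G i (?j + 1)) f = app (comm (?G i ?j) (?G ?j (?j + 1))) f" by simp
  also have "\<dots> = (\<lambda>_. 0)"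
    using Suc simple[of ?j] by (simp add: comm_def app_ops)
  finally show ?case by simp
qed

lemma rep_nilp_zero:
  assumes n: "1 \<le> n" and simple: "\<And>i. 1 \<le> i \<Longrightarrow> i < n \<Longrightarrow> app (gen n Lam i (i + 1)) f = (\<lambda>_. 0)"
    and X: "X \<in> nilp n"
  shows "app (rep n Lam X) f = (\<lambda>_. 0)"
proof
  fix b
  have "app (sc (X i j) * gen n Lam i j) f b = 0" if "i \<in> {1..n}" "j \<in> {1..n}" for i j
  proof (cases "i < j")
    case True
    then have "i + (j - i - 1) + 1 = j" by simp
    with gen_upper_zero[OF n simple, of i "j - i - 1"] that show ?thesis
      by (simp add: app_ops app_sc)
  next
    case False
    then show ?thesis using X by (simp add: nilp_def app_ops app_sc)
  qed
  then show "app (rep n Lam X) f b = 0"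
    by (simp add: rep_def app_sum)
qed

lemma rep_cartan:
  assumes n: "1 \<le> n" and H: "H \<in> cartan n" and b: "V b \<noteq> 0 \<Longrightarrow> b \<in> GammaSet n"
  shows "app (rep n Lam H) (\<lambda>c. V (curry c)) (case_prod b)
    = (lamf n Lam H + (\<Sum>i=1..n. H i i * (of_nat (row n b i) - of_nat (col n b i)))) * V b"
proof -
  have "app (rep n Lam H) (\<lambda>c. V (curry c)) (case_prod b)
      = (\<Sum>i=1..n. \<Sum>j=1..n. if j = i then H i i * (mu_of n Lam i + (of_nat (row n b i) - of_nat (col n b i))) * V b else 0)"
    unfolding rep_def app_sum
  proof (intro sum.cong refl)
    fix i j assume ij: "i \<in> {1..n}" "j \<in> {1..n}"
    show "app (sc (H i j) * gen n Lam i j) (\<lambda>c. V (curry c)) (case_prod b)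
      = (if j = i then H i i * (mu_of n Lam i + (of_nat (row n b i) - of_nat (col n b i))) * V b else 0)"
    proof (cases "j = i")
      case True
      have "app (gen n Lam i i) (\<lambda>c. V (curry c)) (case_prod b)
          = (mu_of n Lam i + (of_nat (row n b i) - of_nat (col n b i))) * V b"
      proof (cases "V b = 0")
        case True
        then show ?thesis using ij gen_diag[of i n Lam V b] by simp
      next
        case False
        then show ?thesis
          using ij gen_diag[of i n Lam V b] row_balanced_sum[OF b, of i] col_balanced_sum[OF b, of i]
          by simp
      qed
      then show ?thesis using True by (simp only: times_lop.rep_eq app_sc refl if_True mult.assoc)
    next
      case False
      then have "H i j = 0" using H by (simp add: cartan_def)
      then show ?thesis using False by (simp add: app_ops app_sc)
    qed
  qed
  also have "\<dots> = (\<Sum>i=1..n. H i i * (mu_of n Lam i + (of_nat (row n b i) - of_nat (col n b i))) * V b)"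
    by (simp add: sum.delta)
  also have "\<dots> = ((\<Sum>i=1..n. H i i * mu_of n Lam i)
      + (\<Sum>i=1..n. H i i * (of_nat (row n b i) - of_nat (col n b i)))) * V b"
    unfolding sum.distrib[symmetric] sum_distrib_right by (simp only: distrib_left)
  finally show ?thesis by (simp only: lamf_mu_of[OF n])
qed

text \<open>As a flow, all m units walk along k, k+1, ..., l without a jump.\<close>

definition staircase :: "nat \<Rightarrow> nat \<Rightarrow> nat \<Rightarrow> nat \<Rightarrow> nat \<Rightarrow> nat" where
  "staircase m k l = (\<lambda>i j. if i = j + 1 \<and> k \<le> j \<and> j < l then m else 0)"

lemma balanced_staircase:
  assumes kl: "1 \<le> k" "k < l" "l \<le> n"
  shows "balanced n m k l (staircase m k l)"
proof -
  have "staircase m k l \<in> GammaSet n" using kl by (auto simp: GammaSet_def staircase_def split: if_splits)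
  moreover have "row n (staircase m k l) p = (if k < p \<and> p \<le> l then m else 0)" if "p \<in> {1..n}" for p
  proof -
    have "row n (staircase m k l) p = (\<Sum>j=1..n. if j = p - 1 then (if k < p \<and> p \<le> l then m else 0) else 0)"
      unfolding row_def staircase_def by (intro sum.cong refl) (use kl that in auto)
    also have "\<dots> = (if k < p \<and> p \<le> l then m else 0)"
      using kl that by (auto simp: sum.delta)
    finally show ?thesis .
  qed
  moreover have "col n (staircase m k l) p = (if k \<le> p \<and> p < l then m else 0)" if "p \<in> {1..n}" for p
  proof -
    have "col n (staircase m k l) p = (\<Sum>i=1..n. if i = p + 1 then (if k \<le> p \<and> p < l then m else 0) else 0)"
      unfolding col_def staircase_def by (intro sum.cong refl) auto
    also have "\<dots> = (if k \<le> p \<and> p < l then m else 0)"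
      using kl that by (auto simp: sum.delta)
    finally show ?thesis .
  qed
  ultimately show ?thesis
    unfolding balanced_def using kl by auto
qed

lemma coeff_staircase_nonzero: "coeff n Lam m k l (staircase m k l) \<noteq> 0"
proof -
  have "r_i n (staircase m k l) t = 0" for t
    unfolding r_i_def staircase_def by (intro sum.neutral ballI) auto
  then show ?thesis
    using facts_prod_pos[of n "staircase m k l"] by (simp add: coeff_wgt wgt_def ffall_def)
qed

section \<open>Values of lambda and rho on the Cartan subalgebra\<close>

lemma rhof_linear: "rhof n (\<lambda>i j. A i j - B i j) = rhof n A - rhof n B"
proof -
  have "(\<Sum>i=1..n. \<Sum>j=i+1..n. (A i i - B i i) - (A j j - B j j))
      = (\<Sum>i=1..n. \<Sum>j=i+1..n. A i i - A j j) - (\<Sum>i=1..n. \<Sum>j=i+1..n. B i i - B j j)"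
    by (simp add: sum_subtractf right_diff_distrib)
  then show ?thesis by (simp only: rhof_def right_diff_distrib)
qed

lemma lamf_linear: "lamf n Lam (\<lambda>i j. A i j - B i j) = lamf n Lam A - lamf n Lam B"
  by (simp add: lamf_def sum_subtractf left_diff_distrib)

text \<open>e_i occurs positively in n - i positive roots and negatively in i - 1 of them.\<close>

lemma rhof_Emat:
  assumes "i \<in> {1..n}" shows "rhof n (Emat i i) = (of_nat n + 1 - 2 * of_nat i) / 2"
proof -
  have "(\<Sum>p=1..n. \<Sum>q=p+1..n. Emat i i p p - Emat i i q q)
      = (\<Sum>p=1..n. \<Sum>q=p+1..n. if p = i then 1 else 0 :: complex) - (\<Sum>p=1..n. \<Sum>q=p+1..n. if q = i then 1 else 0)"
    unfolding sum_subtractf[symmetric] by (intro sum.cong refl) (auto simp: Emat_def)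
  also have "(\<Sum>p=1..n. \<Sum>q=p+1..n. if p = i then 1 else 0 :: complex) = (\<Sum>p=1..n. if p = i then of_nat (n - i) else 0)"
    by (intro sum.cong refl) auto
  also have "\<dots> = of_nat (n - i)" using assms by (simp add: sum.delta)
  also have "(\<Sum>p=1..n. \<Sum>q=p+1..n. if q = i then 1 else 0 :: complex) = (\<Sum>p=1..n. if p < i then 1 else 0)"
    by (intro sum.cong refl) (use assms in \<open>auto simp: sum.delta\<close>)
  also have "\<dots> = (\<Sum>p=1..<i. 1)"
    by (rule sum.mono_neutral_cong_right) (use assms in auto)
  also have "\<dots> = of_nat (i - 1)" by simp
  finally show ?thesis using assms by (simp add: rhof_def of_nat_diff)
qed

lemma lamf_Emat:
  assumes "1 \<le> n" "i \<in> {1..n}" shows "lamf n Lam (Emat i i) = mu_of n Lam i"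
proof -
  have "(\<Sum>p=1..n. Emat i i p p * mu_of n Lam p) = (\<Sum>p=1..n. if p = i then mu_of n Lam i else 0)"
    by (intro sum.cong refl) (auto simp: Emat_def)
  then show ?thesis using assms(2) lamf_mu_of[OF assms(1), of "Emat i i" Lam] by (simp add: sum.delta)
qed

lemma lam_i_simple:
  assumes "1 \<le> i" "i < n" shows "lam_i n Lam i = Lam i + 1"
proof -
  have "lamf n Lam (Emat i i) = mu_of n Lam i" "lamf n Lam (Emat (i + 1) (i + 1)) = mu_of n Lam (i + 1)"
    using assms by (intro lamf_Emat; simp)+
  moreover have "mu_of n Lam i - mu_of n Lam (i + 1) = Lam i"
    using assms by (simp add: mu_of_def sum.atLeast_Suc_lessThan)
  moreover have "rhof n (Emat i i) - rhof n (Emat (i + 1) (i + 1)) = 1"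
    using assms by (simp add: rhof_Emat field_simps)
  ultimately show ?thesis
    by (simp add: lam_i_def Hmat_def lamf_linear rhof_linear)
qed

text \<open>H_k + ... + H_{l-1} telescopes to E_{k,k} - E_{l,l}, the coroot of the
  hypothesis.\<close>

lemma u_i_last:
  assumes kl: "1 \<le> k" "k < l" "l \<le> n"
  shows "u_i n Lam k (l - 1) = lamf n Lam (coroot k l) + rhof n (coroot k l)"
proof -
  define g where "g i = lamf n Lam (Emat i i) + rhof n (Emat i i)" for i
  have "u_i n Lam k (l - 1) = (\<Sum>i=k..l-1. g i - g (Suc i))"
    by (simp add: u_i_def lam_i_def Hmat_def lamf_linear rhof_linear g_def algebra_simps)
  also have "\<dots> = (\<Sum>i=k..<l. g i - g (Suc i))"
    using kl by (intro sum.cong) auto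
  also have "\<dots> = g k - g l"
    using sum_Suc_diff'[of k l g] kl by (simp add: sum_subtractf algebra_simps)
  finally show ?thesis
    by (simp add: coroot_def lamf_linear rhof_linear g_def)
qed

lemma tensors_lmul: "X \<in> sl n \<Longrightarrow> f \<in> tensors n \<Longrightarrow> lmul X f \<in> tensors n"
  unfolding tensors_def by (erule lmul_cspan) (auto simp: words_def intro!: cspan.base imageI)

theorem theorem4p4:
  fixes n k l m :: nat and Lam :: "nat \<Rightarrow> complex"
  assumes "1 \<le> k" and "k < l" and "l \<le> n"
    and "lamf n Lam (coroot k l) + rhof n (coroot k l) = of_nat m"
  shows "singular n Lam (dot_reflect n k l (lamf n Lam))
           (\<lambda>t. \<Sum>a\<in>GammaM n m k l. coeff n Lam m k l a * wd (Eword n a) t)"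
proof -
  let ?v = "\<lambda>t. \<Sum>a\<in>GammaM n m k l. coeff n Lam m k l a * wd (Eword n a) t"
  let ?V = "vcoeff n Lam m k l"
  note kl = assms(1-3)
  have n: "1 \<le> n" using kl by simp
  have fin: "finite (GammaM n m k l)"
    unfolding GammaM_eq_balanced[OF kl] by (rule finite_balanced[OF kl])
  have Eword_mem: "wd (Eword n a) \<in> tensors n" for a
    unfolding tensors_def by (intro cspan.base imageI) (simp add: words_def set_Eword)
  have v: "?v \<in> tensors n"
    unfolding tensors_def by (intro cspan_sum cspan.smult Eword_mem[unfolded tensors_def])
  \<comment> \<open>Distinct ordered words go to distinct monomials, so the image of the vector is
    its own coefficient function, extended by 0 to unbalanced exponents.\<close>
  have phi_v: "phi n Lam ?v = (\<lambda>c. ?V (curry c))"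
  proof
    fix c
    have "phi n Lam ?v c = (\<Sum>a\<in>GammaM n m k l. coeff n Lam m k l a * act n Lam (Eword n a) c)"
      by (simp add: phi_sum phi_scale)
    also have "\<dots> = (\<Sum>a\<in>GammaM n m k l. if a = curry c then coeff n Lam m k l (curry c) else 0)"
    proof (intro sum.cong refl)
      fix a assume "a \<in> GammaM n m k l"
      then have "a \<in> GammaSet n" by (simp add: GammaM_def)
      moreover have "c = case_prod a \<longleftrightarrow> a = curry c" by auto
      ultimately show "coeff n Lam m k l a * act n Lam (Eword n a) c
          = (if a = curry c then coeff n Lam m k l (curry c) else 0)"
        by (simp add: act_Eword mon_def)
    qed
    finally show "phi n Lam ?v c = ?V (curry c)"
      using fin GammaM_eq_balanced[OF kl, of m] by (simp add: sum.delta vcoeff_def)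
  qed
  have um: "u_i n Lam k (l - 1) = of_nat m"
    using u_i_last[OF kl] assms(4) by simp
  have simple: "app (gen n Lam i (i + 1)) (phi n Lam ?v) = (\<lambda>_. 0)" if "1 \<le> i" "i < n" for i
  proof
    fix c
    show "app (gen n Lam i (i + 1)) (phi n Lam ?v) c = 0"
      using gen_simple_vcoeff[OF kl um lam_i_simple that, of "curry c"] by (simp add: phi_v)
  qed
  have "?v \<notin> cspan (Mrels n Lam)"
  proof
    assume "?v \<in> cspan (Mrels n Lam)"
    then have "?V (curry (case_prod (staircase m k l))) = 0"
      using cspan_kernel[OF n] phi_v by (metis (no_types, lifting))
    then show False
      using balanced_staircase[OF kl, of m] coeff_staircase_nonzero[of n Lam m k l] by (simp add: vcoeff_def)
  qed
  moreover have "(\<lambda>t. lmul H ?v t - dot_reflect n k l (lamf n Lam) H * ?v t) \<in> cspan (Mrels n Lam)"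
    if H: "H \<in> cartan n" for H
  proof -
    let ?c = "dot_reflect n k l (lamf n Lam) H"
    \<comment> \<open>Since (lambda + rho) takes the value m on the coroot, the dot reflection
      subtracts m (e_k - e_l) from lambda.\<close>
    have c: "?c = lamf n Lam H + of_nat m * (H l l - H k k)"
      using assms(4) by (simp add: dot_reflect_def reflect_def eroot_def algebra_simps)
    have lv: "lmul H ?v \<in> tensors n" by (intro tensors_lmul cartan_sl H v)
    have "phi n Lam (\<lambda>t. lmul H ?v t - ?c * ?v t) = (\<lambda>_. 0)"
    proof
      fix x
      have "app (rep n Lam H) (\<lambda>c. ?V (curry c)) (case_prod (curry x)) = ?c * ?V (curry x)"
      proof (cases "balanced n m k l (curry x)")
        case True
        then have rc: "row n (curry x) i + (if i = k then m else 0) = col n (curry x) i + (if i = l then m else 0)"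
          if "i \<in> {1..n}" for i
          using that by (simp add: balanced_def)
        have "of_nat (row n (curry x) i) - of_nat (col n (curry x) i)
            = (if i = l then of_nat m else 0) - (if i = k then of_nat m else 0 :: complex)" if "i \<in> {1..n}" for i
          using arg_cong[OF rc[OF that], of "of_nat :: nat \<Rightarrow> complex"]
          by (auto simp: algebra_simps split: if_splits)
        then have "(\<Sum>i=1..n. H i i * (of_nat (row n (curry x) i) - of_nat (col n (curry x) i)))
            = (\<Sum>i=1..n. (if i = l then of_nat m * H l l else 0) - (if i = k then of_nat m * H k k else 0))"
          by (intro sum.cong refl) auto
        also have "\<dots> = of_nat m * (H l l - H k k)"
          using kl by (simp add: sum_subtractf sum.delta right_diff_distrib)
        finally show ?thesis
          using rep_cartan[OF n H, of ?V "curry x"] True by (simp only: c balanced_def)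
      next
        case False
        then show ?thesis using rep_cartan[OF n H, of ?V "curry x"] by (simp add: vcoeff_def)
      qed
      then show "phi n Lam (\<lambda>t. lmul H ?v t - ?c * ?v t) x = 0"
        using fsupp_tensors[OF v] fsupp_tensors[OF lv]
        by (simp add: phi_diff phi_scale phi_lmul phi_v)
    qed
    moreover have "(\<lambda>t. lmul H ?v t - ?c * ?v t) \<in> tensors n"
      using lv v unfolding tensors_def by (intro cspan_diff cspan.smult)
    ultimately show ?thesis by (intro phi_eq_0_imp_cspan n)
  qed
  moreover have "lmul X ?v \<in> cspan (Mrels n Lam)" if X: "X \<in> nilp n" for X
  proof (rule phi_eq_0_imp_cspan[OF n])
    show "lmul X ?v \<in> tensors n" using X by (intro tensors_lmul v) (simp add: nilp_def)
    show "phi n Lam (lmul X ?v) = (\<lambda>_. 0)"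
      unfolding phi_lmul[OF fsupp_tensors[OF v]] by (rule rep_nilp_zero[OF n simple X])
  qed
  ultimately show ?thesis unfolding singular_def by blast
qed

end
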